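(* Let $X$ be a proper extended metric space and $\mathcal H_X$ an ample discrete $X$-module. Then $C^*_{\rm cp}(\mathcal H_X)$ is the multiplier algebra of $C^*_{\rm Roe}(\mathcal H_X)$, i.e. $\mathcal M(C^*_{\rm Roe}(\mathcal H_X))=C^*_{\rm cp}(\mathcal H_X)$ as subalgebras of $\mathcal B(\mathcal H_X)$.
   Context: An extended metric space is a set with a metric allowed to take the value $+\infty$; it is proper if all closed balls of finite radius are compact. A subset is bounded if it has finite diameter; $D\subseteq X$ is coarsely dense if there is $R<\infty$ such that every point of $X$ is within distance $R$ of $D$. An $X$-module is a Hilbert space $\mathcal H_X$ with a unital Boolean algebra $\mathfrak A$ of subsets of $X$ (the measurable sets) and a map $A\mapsto 1_A$ from $\mathfrak A$ to projections in $\mathcal B(\mathcal H_X)$ with $1_{A\cap A'}=1_A1_{A'}$, $1_{A\sqcup A'}=1_A+1_{A'}$ for disjoint $A,A'$, $1_X=\mathrm{id}$, and such that for some $r\geq 0$ the subspaces $1_A(\mathcal H_X)$, with $A$ measurable of diameter $\le r$, span a dense subspace. It is discrete if there are $r\ge0$ and a partition $X=\bigsqcup_i A_i$ into measurable sets of diameter $\le r$ with $\sum_i 1_{A_i}=1$ strongly and such that $C\subseteq X$ is measurable whenever every $C\cap A_i$ is. It is ample if for some $r\ge 0$ the union of the measurable sets $A$ of diameter $\le r$ with $1_A$ of infinite rank is coarsely dense in $X$. An operator $t\in\mathcal B(\mathcal H_X)$ has propagation at most $r$ if $1_{A'}t1_A=0$ for all measurable $A,A'$ with $d(a',a)>r$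 for all $a\in A,a'\in A'$; it is locally compact if $t1_A$ and $1_At$ are compact for every bounded measurable $A$. $C^*_{\rm cp}(\mathcal H_X)$ is the norm closure of the operators of finite propagation, $C^*_{\rm Roe}(\mathcal H_X)$ the norm closure of the locally compact operators of finite propagation. The multiplier algebra of the non-degenerate algebra $C^*_{\rm Roe}(\mathcal H_X)\subseteq\mathcal B(\mathcal H_X)$ is identified with its idealizer $\{t\in\mathcal B(\mathcal H_X)\mid ts,st\in C^*_{\rm Roe}(\mathcal H_X)\ \forall s\in C^*_{\rm Roe}(\mathcal H_X)\}$. *)

theory Defs
  imports "HOL-Analysis.Analysis"
begin

section \<open>Complex Hilbert spaces\<close>

text \<open>
  The underlying real Hilbert space carries the metric and the norm; its inner product is the real
  part of the complex one, so that the norm is the one induced by the complex inner product.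
  The inner product is antilinear in the first argument.
\<close>

class complex_hilbert_space = real_inner + complete_space +
  fixes scaleC :: "complex \<Rightarrow> 'a \<Rightarrow> 'a" (infixr \<open>*\<^sub>C\<close> 75)
    and cinner :: "'a \<Rightarrow> 'a \<Rightarrow> complex"
  assumes scaleC_add_right: "a *\<^sub>C (x + y) = a *\<^sub>C x + a *\<^sub>C y"
    and scaleC_add_left: "(a + b) *\<^sub>C x = a *\<^sub>C x + b *\<^sub>C x"
    and scaleC_scaleC: "a *\<^sub>C (b *\<^sub>C x) = (a * b) *\<^sub>C x"
    and scaleC_of_real: "complex_of_real r *\<^sub>C x = r *\<^sub>R x"
    and cinner_commute: "cinner x y = cnj (cinner y x)"
    and cinner_add_right: "cinner x (y + z) = cinner x y + cinner x z"
    and cinner_scaleC_right: "cinner x (a *\<^sub>C y) = a * cinner x y"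
    and Re_cinner: "Re (cinner x y) = inner x y"

lemma vector_space_scaleC:
  "vector_space (scaleC :: complex \<Rightarrow> 'a \<Rightarrow> 'a::complex_hilbert_space)"
proof
  show "1 *\<^sub>C x = x" for x :: 'a
    using scaleC_of_real[of 1 x] by simp
qed (simp_all add: scaleC_add_right scaleC_add_left scaleC_scaleC)

instantiation complex :: complex_hilbert_space
begin

definition scaleC_complex :: "complex \<Rightarrow> complex \<Rightarrow> complex" where
  "scaleC_complex a x = a * x"

definition cinner_complex :: "complex \<Rightarrow> complex \<Rightarrow> complex" where
  "cinner_complex x y = cnj x * y"

instance
  by standard
    (simp_all add: scaleC_complex_def cinner_complex_def algebra_simps scaleR_conv_of_real
      inner_complex_def)

end

abbreviation cspan :: "'a::complex_hilbert_space set \<Rightarrow> 'a set" where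
  "cspan \<equiv> module.span scaleC"


section \<open>Bounded operators\<close>

text \<open>
  The library type of bounded real-linear maps supplies the operator norm and composition;
  the algebra of bounded operators is its norm-closed subset of complex-linear maps.
\<close>

definition bounded_operators :: "('h::complex_hilbert_space \<Rightarrow>\<^sub>L 'h) set" where
  "bounded_operators = {t. \<forall>c x. blinfun_apply t (c *\<^sub>C x) = c *\<^sub>C blinfun_apply t x}"

definition orthogonal_projection :: "('h::complex_hilbert_space \<Rightarrow>\<^sub>L 'h) \<Rightarrow> bool" where
  "orthogonal_projection p \<longleftrightarrow>
     p \<in> bounded_operators \<and> p o\<^sub>L p = p \<and>
     (\<forall>x y. cinner (blinfun_apply p x) y = cinner x (blinfun_apply p y))"

definition compact_operator :: "('h::complex_hilbert_space \<Rightarrow>\<^sub>L 'h) \<Rightarrow> bool" where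
  "compact_operator t \<longleftrightarrow>
     t \<in> bounded_operators \<and> compact (closure (blinfun_apply t ` cball 0 1))"

definition infinite_rank :: "('h::complex_hilbert_space \<Rightarrow>\<^sub>L 'h) \<Rightarrow> bool" where
  "infinite_rank t \<longleftrightarrow> \<not> (\<exists>B. finite B \<and> range (blinfun_apply t) \<subseteq> cspan B)"

text \<open>
  The multiplier algebra of a non-degenerate algebra of operators, realised as its idealizer.
\<close>

definition multiplier_algebra ::
    "('h::complex_hilbert_space \<Rightarrow>\<^sub>L 'h) set \<Rightarrow> ('h \<Rightarrow>\<^sub>L 'h) set" where
  "multiplier_algebra \<A> =
     {t \<in> bounded_operators. \<forall>s\<in>\<A>. t o\<^sub>L s \<in> \<A> \<and> s o\<^sub>L t \<in> \<A>}"


section \<open>Extended metric spaces\<close>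

locale extended_metric_space =
  fixes X :: "'x set" and d :: "'x \<Rightarrow> 'x \<Rightarrow> ennreal"
  assumes dist_zero: "\<lbrakk>x \<in> X; y \<in> X\<rbrakk> \<Longrightarrow> d x y = 0 \<longleftrightarrow> x = y"
    and dist_commute: "\<lbrakk>x \<in> X; y \<in> X\<rbrakk> \<Longrightarrow> d x y = d y x"
    and dist_triangle: "\<lbrakk>x \<in> X; y \<in> X; z \<in> X\<rbrakk> \<Longrightarrow> d x z \<le> d x y + d y z"
begin

definition eball :: "'x \<Rightarrow> ennreal \<Rightarrow> 'x set" where
  "eball x r = {y \<in> X. d x y < r}"

definition ecball :: "'x \<Rightarrow> ennreal \<Rightarrow> 'x set" where
  "ecball x r = {y \<in> X. d x y \<le> r}"

definition etopology :: "'x topology" where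
  "etopology = topology (\<lambda>U. U \<subseteq> X \<and> (\<forall>x\<in>U. \<exists>r>0. eball x r \<subseteq> U))"

lemma openin_etopology:
  "openin etopology U \<longleftrightarrow> U \<subseteq> X \<and> (\<forall>x\<in>U. \<exists>r>0. eball x r \<subseteq> U)"
proof -
  have "istopology (\<lambda>U. U \<subseteq> X \<and> (\<forall>x\<in>U. \<exists>r>0. eball x r \<subseteq> U))"
    unfolding istopology_def
  proof (intro conjI allI impI)
    fix S T
    assume S: "S \<subseteq> X \<and> (\<forall>x\<in>S. \<exists>r>0. eball x r \<subseteq> S)"
      and T: "T \<subseteq> X \<and> (\<forall>x\<in>T. \<exists>r>0. eball x r \<subseteq> T)"
    show "S \<inter> T \<subseteq> X" using S by blast
    show "\<forall>x\<in>S \<inter> T. \<exists>r>0. eball x r \<subseteq> S \<inter> T"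
    proof
      fix x assume "x \<in> S \<inter> T"
      then obtain r s where "r > 0" "eball x r \<subseteq> S" "s > 0" "eball x s \<subseteq> T"
        using S T by blast
      then have "min r s > 0" "eball x (min r s) \<subseteq> S \<inter> T"
        by (auto simp: eball_def)
      then show "\<exists>r>0. eball x r \<subseteq> S \<inter> T" by blast
    qed
  next
    fix \<K>
    assume "\<forall>K\<in>\<K>. K \<subseteq> X \<and> (\<forall>x\<in>K. \<exists>r>0. eball x r \<subseteq> K)"
    then show "\<Union>\<K> \<subseteq> X" "\<forall>x\<in>\<Union>\<K>. \<exists>r>0. eball x r \<subseteq> \<Union>\<K>"
      by (blast, meson UnionE Union_upper subset_trans)
  qed
  then show ?thesis by (simp add: etopology_def topology_inverse')
qed

definition proper :: bool where
  "proper \<longleftrightarrow> (\<forall>x\<in>X. \<forall>r<\<infinity>. compactin etopology (ecball x r))"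

definition diam :: "'x set \<Rightarrow> ennreal" where
  "diam A = (SUP x\<in>A. SUP y\<in>A. d x y)"

definition coarsely_dense :: "'x set \<Rightarrow> bool" where
  "coarsely_dense D \<longleftrightarrow> D \<subseteq> X \<and> (\<exists>R<\<infinity>. \<forall>x\<in>X. \<exists>y\<in>D. d x y \<le> R)"

end


section \<open>Modules over extended metric spaces\<close>

text \<open>
  \<open>P A\<close> is the projection written $1_A$; it is only meaningful for \<open>A \<in> \<AA>\<close>.
\<close>

locale X_module = extended_metric_space X d
  for X :: "'x set" and d :: "'x \<Rightarrow> 'x \<Rightarrow> ennreal" +
  fixes \<AA> :: "'x set set" and P :: "'x set \<Rightarrow> ('h::complex_hilbert_space \<Rightarrow>\<^sub>L 'h)"
  assumes measurable_algebra: "algebra X \<AA>"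
    and projection: "A \<in> \<AA> \<Longrightarrow> orthogonal_projection (P A)"
    and P_Int: "\<lbrakk>A \<in> \<AA>; A' \<in> \<AA>\<rbrakk> \<Longrightarrow> P (A \<inter> A') = P A o\<^sub>L P A'"
    and P_Un: "\<lbrakk>A \<in> \<AA>; A' \<in> \<AA>; A \<inter> A' = {}\<rbrakk> \<Longrightarrow> P (A \<union> A') = P A + P A'"
    and P_X: "P X = id_blinfun"
    and dense_span: "\<exists>r<\<infinity>.
      closure (cspan (\<Union>A\<in>{A \<in> \<AA>. diam A \<le> r}. range (blinfun_apply (P A)))) = UNIV"
begin

text \<open>Strong convergence of the sum is convergence of the net of finite partial sums.\<close>

definition discrete :: bool where
  "discrete \<longleftrightarrow> (\<exists>r<\<infinity>. \<exists>\<P>.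
     partition_on X \<P> \<and> \<P> \<subseteq> \<AA> \<and> (\<forall>A\<in>\<P>. diam A \<le> r) \<and>
     (\<forall>x. ((\<lambda>A. blinfun_apply (P A) x) has_sum x) \<P>) \<and>
     (\<forall>C. C \<subseteq> X \<longrightarrow> (\<forall>A\<in>\<P>. C \<inter> A \<in> \<AA>) \<longrightarrow> C \<in> \<AA>))"

definition ample :: bool where
  "ample \<longleftrightarrow> (\<exists>r<\<infinity>. coarsely_dense (\<Union>{A \<in> \<AA>. diam A \<le> r \<and> infinite_rank (P A)}))"

definition propagation_at_most :: "('h \<Rightarrow>\<^sub>L 'h) \<Rightarrow> ennreal \<Rightarrow> bool" where
  "propagation_at_most t r \<longleftrightarrow>
     (\<forall>A\<in>\<AA>. \<forall>A'\<in>\<AA>. (\<forall>a\<in>A. \<forall>a'\<in>A'. d a' a > r) \<longrightarrow> P A' o\<^sub>L t o\<^sub>L P A = 0)"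

definition finite_propagation :: "('h \<Rightarrow>\<^sub>L 'h) \<Rightarrow> bool" where
  "finite_propagation t \<longleftrightarrow> (\<exists>r<\<infinity>. propagation_at_most t r)"

definition locally_compact_operator :: "('h \<Rightarrow>\<^sub>L 'h) \<Rightarrow> bool" where
  "locally_compact_operator t \<longleftrightarrow>
     (\<forall>A\<in>\<AA>. diam A < \<infinity> \<longrightarrow> compact_operator (t o\<^sub>L P A) \<and> compact_operator (P A o\<^sub>L t))"

definition C_cp :: "('h \<Rightarrow>\<^sub>L 'h) set" where
  "C_cp = closure {t \<in> bounded_operators. finite_propagation t}"

definition C_Roe :: "('h \<Rightarrow>\<^sub>L 'h) set" where
  "C_Roe = closure {t \<in> bounded_operators. locally_compact_operator t \<and> finite_propagation t}"

end

end

theory Submission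
  imports Defs
begin

text \<open>
  By properness, a discrete module admits a locally finite partition into pieces of bounded size.
  Hence every sum \<open>q\<close> of finite rank projections, one below the projection of each piece, lies in the
  Roe algebra, although no bound on the ranks is imposed; such \<open>q\<close> are the test elements for a
  multiplier \<open>t\<close>.

  Restricted to one piece, \<open>t\<close> is a norm limit of operators of finite propagation: otherwise
  infinitely many disjoint humps of its column would be seen by a single \<open>q t\<close>, which is compact on
  that piece. If now \<open>t\<close> had positive distance to the operators of propagation at most \<open>n\<close>, uniformly
  in \<open>n\<close>, this would remain so after deleting finitely many pieces, and by compactness of balls in the
  weak operator topology it would be visible on finitely many of the remaining pieces after compression
  to finite rank. Choosing such humps disjointly for all \<open>n\<close> and assembling them gives a single \<open>q\<close> for
  which \<open>t q\<close> is no limit of operators of finite propagation.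
\<close>

section \<open>Operators on complex Hilbert spaces\<close>

text \<open>The projection of a single piece may have infinite rank, so \<open>P B\<close> need not
  lie in \<open>C_Roe\<close>, and even for one column \<open>t o\<^sub>L P B\<close> membership in
  \<open>C_cp\<close> is not immediate. Columns are therefore cut from the left:
  \<open>q o\<^sub>L t\<close> lies in \<open>C_Roe\<close>, hence is compact on a bounded piece.
  The global step multiplies from the right and uses only that \<open>t o\<^sub>L q\<close> lies in
  \<open>C_cp\<close>. Two stability properties carry the passage from finite rank to
  \<open>t\<close>. A bound on the propagation and a norm bound on the error both survive weak
  operator limits, so approximants chosen without any compatibility still yield one approximant.
  Right multiplication by a projection \<open>P B\<close> does not enlarge propagation, so an
  approximant of \<open>t o\<^sub>L q\<close> of propagation \<open>n\<close> restricts to the hump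
  of index \<open>n\<close>, which was chosen to exclude exactly that propagation. Since distances
  may be infinite, two bounded pieces need not be at finite distance from each other, and single
  matrix entries of \<open>t\<close> already require an argument.\<close>

lemma cinner_scaleC_left: "cinner (a *\<^sub>C x) y = cnj a * cinner x y"
  by (metis cinner_commute cinner_scaleC_right complex_cnj_mult)

lemma inner_scaleC_right: "inner x (a *\<^sub>C y) = inner (cnj a *\<^sub>C x) y"
  by (simp add: cinner_scaleC_left cinner_scaleC_right flip: Re_cinner)

lemma scaleC_zero_right [simp]: "a *\<^sub>C (0::'a::complex_hilbert_space) = 0"
  by (metis add_cancel_left_left scaleC_add_right)

lemma scaleC_zero_left [simp]: "0 *\<^sub>C (x::'a::complex_hilbert_space) = 0"
  by (metis of_real_0 scaleC_of_real scaleR_zero_left)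

lemma scaleC_one [simp]: "1 *\<^sub>C (x::'a::complex_hilbert_space) = x"
  by (metis of_real_1 scaleC_of_real scaleR_one)

lemma cinner_zero_left [simp]: "cinner 0 x = 0"
  using cinner_scaleC_left[of 0 0 x] by simp

lemma Im_cinner: "Im (cinner x y) = inner (\<i> *\<^sub>C x) y"
  by (simp add: cinner_scaleC_left flip: Re_cinner)

lemma cinner_self: "cinner x x = complex_of_real ((norm x)\<^sup>2)"
proof (rule complex_eqI)
  show "Im (cinner x x) = Im (complex_of_real ((norm x)\<^sup>2))"
    using arg_cong[where f = Im, OF cinner_commute[of x x]] by simp
qed (simp add: Re_cinner power2_norm_eq_inner)

lemma norm_scaleC: "norm (a *\<^sub>C x) = cmod a * norm x"
proof -
  have "complex_of_real ((norm (a *\<^sub>C x))\<^sup>2) = cnj a * a * cinner x x"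
    by (metis cinner_self cinner_scaleC_left cinner_scaleC_right mult.assoc mult.commute)
  also have "\<dots> = complex_of_real ((cmod a * norm x)\<^sup>2)"
    by (simp add: cinner_self power_mult_distrib complex_mult_cnj cmod_power2 mult.commute)
  finally have "(norm (a *\<^sub>C x))\<^sup>2 = (cmod a * norm x)\<^sup>2"
    using of_real_eq_iff by blast
  then show ?thesis
    by (simp add: power2_eq_iff_nonneg)
qed

lemma bounded_linear_scaleC_right:
  "bounded_linear (\<lambda>x :: 'a::complex_hilbert_space. a *\<^sub>C x)"
proof (rule bounded_linear_intro)
  show "a *\<^sub>C (r *\<^sub>R x) = r *\<^sub>R (a *\<^sub>C x)" for r and x :: 'a
    by (metis scaleC_of_real scaleC_scaleC mult.commute)
  show "norm (a *\<^sub>C x) \<le> norm x * cmod a" for x :: 'a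
    by (simp add: norm_scaleC mult.commute)
qed (rule scaleC_add_right)

lemma bounded_linear_scaleC_left:
  "bounded_linear (\<lambda>a. a *\<^sub>C (x :: 'a::complex_hilbert_space))"
proof (rule bounded_linear_intro)
  show "(r *\<^sub>R a) *\<^sub>C x = r *\<^sub>R (a *\<^sub>C x)" for r a
    by (metis scaleC_of_real scaleC_scaleC scaleR_conv_of_real)
  show "norm (a *\<^sub>C x) \<le> norm a * norm x" for a
    by (simp add: norm_scaleC)
qed (rule scaleC_add_left)

lemma bounded_linear_cinner: "bounded_linear (cinner x)"
proof (rule bounded_linear_intro[where K = "2 * norm x"])
  show "cinner x (r *\<^sub>R y) = r *\<^sub>R cinner x y" for r y
    by (simp add: cinner_scaleC_right scaleR_conv_of_real flip: scaleC_of_real)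
  show "norm (cinner x y) \<le> norm y * (2 * norm x)" for y
  proof -
    \<comment> \<open>Real and imaginary part are both real inner products, so the real
      Cauchy-Schwarz inequality applies to each; the resulting factor 2 is not sharp, but only
      boundedness matters.\<close>
    have "norm (cinner x y) \<le> \<bar>Re (cinner x y)\<bar> + \<bar>Im (cinner x y)\<bar>"
      by (rule cmod_le)
    also have "\<dots> \<le> norm x * norm y + norm (\<i> *\<^sub>C x) * norm y"
      unfolding Re_cinner Im_cinner by (intro add_mono Cauchy_Schwarz_ineq2)
    finally show ?thesis by (simp add: norm_scaleC algebra_simps)
  qed
qed (rule cinner_add_right)

subsection \<open>Weak compactness\<close>

text \<open>The representing vector is the minimiser of the energy \<open>J\<close>: a minimising
  sequence is Cauchy by the parallelogram law, and the first variation of \<open>J\<close> at its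
  limit gives \<open>f y = inner z y\<close>.\<close>

lemma riesz_representation:
  fixes f :: "'a::{real_inner, complete_space} \<Rightarrow> real"
  assumes "bounded_linear f"
  obtains z where "\<And>x. f x = inner z x"
proof -
  interpret f: bounded_linear f by fact
  define J where "J x = (norm x)\<^sup>2 - 2 * f x" for x
  obtain C where C: "\<And>x. norm (f x) \<le> norm x * C" using f.bounded by blast
  have J_ge: "- C\<^sup>2 \<le> J x" for x
  proof -
    have "0 \<le> (norm x - C)\<^sup>2" by simp
    moreover have "f x \<le> norm x * C" using C[of x] by simp
    ultimately show ?thesis by (simp add: J_def power2_diff)
  qed
  then have bdd: "bdd_below (range J)" by (meson bdd_belowI2)
  define m where "m = (INF x. J x)"
  have m_le: "m \<le> J x" for x
    unfolding m_def by (rule cINF_lower[OF bdd]) simp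
  have "\<exists>x. J x < m + 1 / real (Suc n)" for n
  proof -
    have "m < m + 1 / real (Suc n)" by simp
    then show ?thesis
      using cINF_less_iff[OF _ bdd, of "m + 1 / real (Suc n)"] unfolding m_def by blast
  qed
  then obtain x where x: "\<And>n. J (x n) < m + 1 / real (Suc n)" by metis
  \<comment> \<open>The parallelogram law, with \<open>m\<close> as lower bound for \<open>J\<close>
    at the midpoint: near-minimisers are close to each other.\<close>
  have para: "(norm (a - b))\<^sup>2 \<le> 2 * (J a + J b - 2 * m)" for a b
  proof -
    have "2 * J ((1/2) *\<^sub>R (a + b)) = (norm (a + b))\<^sup>2 / 2 - 2 * (f a + f b)"
      unfolding J_def f.scaleR norm_scaleR f.add power_mult_distrib by (simp add: field_simps)
    moreover have "(norm (a - b))\<^sup>2 + (norm (a + b))\<^sup>2 = 2 * (norm a)\<^sup>2 + 2 * (norm b)\<^sup>2"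
      by (simp add: power2_norm_eq_inner algebra_simps)
    ultimately show ?thesis
      using m_le[of "(1/2) *\<^sub>R (a + b)"] by (simp add: J_def)
  qed
  have "Cauchy x"
  proof (rule metric_CauchyI)
    fix e :: real assume "e > 0"
    then have "0 < e\<^sup>2 / 4" by simp
    then obtain M where M: "1 / real (Suc M) < e\<^sup>2 / 4" by (rule nat_approx_posE)
    have J_less: "J (x n) < m + e\<^sup>2 / 4" if "n \<ge> M" for n
    proof -
      note x[of n]
      also have "1 / real (Suc n) \<le> 1 / real (Suc M)" using that by (simp add: frac_le)
      also note M
      finally show ?thesis by simp
    qed
    have "dist (x i) (x j) < e" if "i \<ge> M" "j \<ge> M" for i j
    proof -
      have "(dist (x i) (x j))\<^sup>2 < e\<^sup>2"
        using para[of "x i" "x j"] J_less[OF that(1)] J_less[OF that(2)]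
        unfolding dist_norm by argo
      then show ?thesis using \<open>e > 0\<close> by (simp add: power_less_imp_less_base)
    qed
    then show "\<exists>M. \<forall>i\<ge>M. \<forall>j\<ge>M. dist (x i) (x j) < e" by blast
  qed
  then obtain z where z: "x \<longlonglongrightarrow> z" using Cauchy_convergent convergent_def by blast
  have "(\<lambda>n. J (x n)) \<longlonglongrightarrow> J z"
    unfolding J_def by (intro tendsto_intros f.tendsto z)
  moreover have "(\<lambda>n. m + 1 / real (Suc n)) \<longlonglongrightarrow> m + 0"
    by (intro tendsto_add tendsto_const LIMSEQ_Suc[OF lim_1_over_n])
  ultimately have "J z \<le> m"
    using x by (intro LIMSEQ_le[of "\<lambda>n. J (x n)" _ "\<lambda>n. m + 1 / real (Suc n)"])
      (auto intro: less_imp_le)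
  have "f y = inner z y" for y
  proof (rule ccontr)
    assume ne: "f y \<noteq> inner z y"
    define k where "k = inner z y - f y"
    \<comment> \<open>The minimiser of the quadratic
      \<open>s\<^sup>2 * (norm y)\<^sup>2 + 2 * s * k\<close>; a nonzero \<open>k\<close> would push
      \<open>J\<close> strictly below \<open>m\<close>.\<close>
    define s where "s = - k / (norm y)\<^sup>2"
    have "y \<noteq> 0" using ne f.zero by auto
    have "J (z + s *\<^sub>R y) = J z + s\<^sup>2 * (norm y)\<^sup>2 + 2 * s * k"
      unfolding J_def k_def f.add f.scaleR power2_norm_eq_inner
      by (simp add: algebra_simps power2_eq_square inner_commute)
    moreover have "s\<^sup>2 * (norm y)\<^sup>2 + 2 * s * k = - (k\<^sup>2 / (norm y)\<^sup>2)"
      using \<open>y \<noteq> 0\<close> by (simp add: s_def field_simps power2_eq_square)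
    ultimately have "J (z + s *\<^sub>R y) = J z - k\<^sup>2 / (norm y)\<^sup>2" by linarith
    moreover have "k\<^sup>2 / (norm y)\<^sup>2 > 0"
      using ne \<open>y \<noteq> 0\<close> by (simp add: k_def)
    ultimately show False
      using m_le[of "z + s *\<^sub>R y"] \<open>J z \<le> m\<close> by linarith
  qed
  then show thesis by (rule that)
qed

text \<open>The choice \<open>x = t y\<close> makes a one-sided bound on matrix coefficients
  suffice, and such bounds pass to weak limits.\<close>

lemma norm_blinfun_le_inner:
  fixes t :: "'a::real_inner \<Rightarrow>\<^sub>L 'b::real_inner"
  assumes "0 \<le> C" and "\<And>x y. inner x (t y) \<le> C * norm x * norm y"
  shows "norm t \<le> C"
proof (rule norm_blinfun_bound[OF assms(1)])
  fix y
  have "norm (t y) * norm (t y) \<le> (C * norm y) * norm (t y)"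
    using assms(2)[of "t y" y] by (simp add: norm_eq_sqrt_inner algebra_simps)
  then show "norm (t y) \<le> C * norm y"
    using assms(1) by (cases "norm (t y) = 0") (auto simp: mult_le_cancel_right)
qed

lemma inner_blinfun_le: "inner x (blinfun_apply t y) \<le> norm t * norm x * norm y"
proof -
  have "inner x (t y) \<le> norm x * norm (t y)" by (rule norm_cauchy_schwarz)
  also have "\<dots> \<le> norm x * (norm t * norm y)"
    by (intro mult_left_mono norm_blinfun) simp
  finally show ?thesis by (simp add: algebra_simps)
qed

text \<open>Tychonoff's theorem for the matrix coefficients, phrased with a refinement of the filter so
  that all linear relations pass to the limit.\<close>

lemma weak_operator_compactness:
  fixes a :: "'i \<Rightarrow> 'h::{real_inner, complete_space} \<Rightarrow>\<^sub>L 'h"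
  assumes "F \<noteq> bot" and C: "\<And>i. norm (a i) \<le> C"
  obtains F' and b :: "'h \<Rightarrow>\<^sub>L 'h" where "F' \<noteq> bot" and "F' \<le> F"
    and "\<And>x y. ((\<lambda>i. inner x (a i y)) \<longlongrightarrow> inner x (b y)) F'"
    and "norm b \<le> C"
proof -
  define g where "g i = (\<lambda>(x, y). inner x (a i y))" for i
  \<comment> \<open>A product of compact intervals, one for each pair of vectors, containing the
    coefficient families of all \<open>a i\<close>.\<close>
  define K where "K = (\<Pi>\<^sub>E (p::'h \<times> 'h) \<in> UNIV. cball (0::real) (C * norm (fst p) * norm (snd p)))"
  have C0: "0 \<le> C" using C[of undefined] norm_ge_zero order_trans by blast
  have le: "\<bar>inner x (a i y)\<bar> \<le> C * norm x * norm y" for i x y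
  proof -
    have "\<bar>inner x (a i y)\<bar> \<le> norm x * norm (a i y)" by (rule Cauchy_Schwarz_ineq2)
    also have "\<dots> \<le> norm x * (norm (a i) * norm y)"
      by (intro mult_left_mono norm_blinfun) simp
    also have "\<dots> \<le> norm x * (C * norm y)"
      by (intro mult_left_mono mult_right_mono C) auto
    finally show ?thesis by (simp add: algebra_simps)
  qed
  have "compactin (product_topology (\<lambda>p. euclidean) UNIV) K"
    unfolding K_def compactin_PiE by simp
  then have "compact K" by (simp add: euclidean_product_topology)
  moreover have "g i \<in> K" for i
    using le by (auto simp: g_def K_def)
  moreover have "filtermap g F \<noteq> bot"
    using \<open>F \<noteq> bot\<close> by (simp add: filtermap_bot_iff)
  ultimately obtain f where "f \<in> K" and f: "inf (nhds f) (filtermap g F) \<noteq> bot"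
    unfolding compact_filter using always_eventually[of "\<lambda>x. x \<in> K"]
    by (metis (lifting) eventually_filtermap always_eventually)
  \<comment> \<open>The indices of \<open>F\<close> at which the coefficients are near the cluster
    point \<open>f\<close>; clustering is precisely what makes this filter proper.\<close>
  define F' where "F' = inf F (filtercomap g (nhds f))"
  have "F' \<noteq> bot"
  proof
    assume "F' = bot"
    then obtain Q R where "eventually Q F" "eventually R (filtercomap g (nhds f))"
      and QR: "\<And>i. Q i \<Longrightarrow> R i \<Longrightarrow> False"
      unfolding F'_def trivial_limit_def eventually_inf by blast
    then obtain R' where R': "eventually R' (nhds f)" "\<And>i. R' (g i) \<Longrightarrow> R i"
      unfolding eventually_filtercomap by blast
    have "eventually (\<lambda>h. \<not> R' h) (filtermap g F)"
      unfolding eventually_filtermap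
      by (rule eventually_mono[OF \<open>eventually Q F\<close>]) (use QR R'(2) in blast)
    with R'(1) have "inf (filtermap g F) (nhds f) = bot"
      unfolding trivial_limit_def eventually_inf by blast
    then show False using f by (simp add: inf.commute)
  qed
  have "(g \<longlongrightarrow> f) F'"
    unfolding F'_def filterlim_def
    using order_trans[OF filtermap_mono[OF inf_le2] filtermap_filtercomap] .
  then have lim: "((\<lambda>i. inner x (a i y)) \<longlongrightarrow> f (x, y)) F'" for x y
    using continuous_on_tendsto_compose[OF continuous_on_product_coordinates[of "(x, y)"], of g f F']
    by (simp add: g_def)
  have eqI: "r = s" if "((\<lambda>i. h i) \<longlongrightarrow> r) F'" "((\<lambda>i. h i) \<longlongrightarrow> s) F'" for h :: "'i \<Rightarrow> real" and r s
    using that \<open>F' \<noteq> bot\<close> by (metis tendsto_unique)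
  have f_le: "\<bar>f (x, y)\<bar> \<le> C * norm x * norm y" for x y
    using \<open>f \<in> K\<close> by (auto simp: K_def PiE_iff)
  have f1: "f (x + x', y) = f (x, y) + f (x', y)" for x x' y
    by (rule eqI[OF lim]) (unfold inner_add_left, intro tendsto_intros lim)
  have f2: "f (r *\<^sub>R x, y) = r * f (x, y)" for x y r
    by (rule eqI[OF lim]) (unfold inner_scaleR_left, intro tendsto_intros lim)
  have f3: "f (x, y + y') = f (x, y) + f (x, y')" for x y y'
    by (rule eqI[OF lim]) (unfold blinfun.add_right inner_add_right, intro tendsto_intros lim)
  have f4: "f (x, r *\<^sub>R y) = r * f (x, y)" for x y r
    by (rule eqI[OF lim]) (unfold blinfun.scaleR_right inner_scaleR_right, intro tendsto_intros lim)
  have "bounded_linear (\<lambda>x. f (x, y))" for y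
    by (rule bounded_linear_intro[where K = "C * norm y"])
      (use f1 f2 f_le in \<open>auto simp: algebra_simps\<close>)
  then have "\<exists>z. \<forall>x. f (x, y) = inner z x" for y
    by (rule riesz_representation) blast
  then obtain B where B: "\<And>x y. f (x, y) = inner (B y) x" by metis
  have norm_B: "norm (B y) \<le> C * norm y" for y
  proof -
    have "norm (B y) * norm (B y) \<le> (C * norm y) * norm (B y)"
      using f_le[of "B y" y] by (simp add: B norm_eq_sqrt_inner algebra_simps)
    then show ?thesis
      using C0 by (cases "norm (B y) = 0") (auto simp: mult_le_cancel_right)
  qed
  have "bounded_linear B"
  proof (rule bounded_linear_intro[where K = C])
    show "B (y + y') = B y + B y'" for y y'
      by (subst vector_eq_rdot[symmetric]) (simp add: inner_add_left f3 flip: B)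
    show "B (r *\<^sub>R y) = r *\<^sub>R B y" for r y
      by (subst vector_eq_rdot[symmetric]) (simp add: f4 flip: B)
    show "norm (B y) \<le> norm y * C" for y
      using norm_B[of y] by (simp add: mult.commute)
  qed
  then have app: "blinfun_apply (Blinfun B) = B" by (rule bounded_linear_Blinfun_apply)
  show thesis
  proof (rule that[OF \<open>F' \<noteq> bot\<close>, of "Blinfun B"])
    show "F' \<le> F" by (simp add: F'_def)
    show "((\<lambda>i. inner x (a i y)) \<longlongrightarrow> inner x (Blinfun B y)) F'" for x y
      using lim[of x y] by (simp add: B app inner_commute)
    show "norm (Blinfun B) \<le> C"
      by (rule norm_blinfun_bound[OF C0]) (simp add: app norm_B)
  qed
qed

subsection \<open>Bounded operators and projections\<close>

lemmas blinfun_compose_bilinear_simps =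
  bounded_bilinear.add_left[OF bounded_bilinear_blinfun_compose]
  bounded_bilinear.add_right[OF bounded_bilinear_blinfun_compose]
  bounded_bilinear.diff_left[OF bounded_bilinear_blinfun_compose]
  bounded_bilinear.diff_right[OF bounded_bilinear_blinfun_compose]
  bounded_bilinear.zero_left[OF bounded_bilinear_blinfun_compose]
  bounded_bilinear.zero_right[OF bounded_bilinear_blinfun_compose]

lemma blinfun_compose_assoc: "(a o\<^sub>L b) o\<^sub>L c = a o\<^sub>L (b o\<^sub>L c)"
  by (rule blinfun_eqI) simp

lemma blinfun_eq_innerI:
  fixes s t :: "'a::real_normed_vector \<Rightarrow>\<^sub>L 'b::real_inner"
  assumes "\<And>x y. inner x (s y) = inner x (t y)"
  shows "s = t"
proof (rule blinfun_eqI)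
  fix y
  have "inner (s y - t y) (s y - t y) = 0"
    using assms[of "s y - t y" y] by (simp add: inner_diff_right)
  then show "s y = t y" by simp
qed

lemma closure_blinfun_compose:
  fixes S :: "('b::real_normed_vector \<Rightarrow>\<^sub>L 'c::real_normed_vector) set"
    and T :: "('a::real_normed_vector \<Rightarrow>\<^sub>L 'b) set"
  assumes "s \<in> closure S" and "t \<in> closure T"
    and "\<And>s t. s \<in> S \<Longrightarrow> t \<in> T \<Longrightarrow> s o\<^sub>L t \<in> U"
  shows "s o\<^sub>L t \<in> closure U"
proof -
  obtain f g where f: "\<And>n. f n \<in> S" "f \<longlonglongrightarrow> s" and g: "\<And>n. g n \<in> T" "g \<longlonglongrightarrow> t"
    using assms(1,2) unfolding closure_sequential by blast
  have "(\<lambda>n. f n o\<^sub>L g n) \<longlonglongrightarrow> (s o\<^sub>L t)"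
    by (rule bounded_bilinear.tendsto[OF bounded_bilinear_blinfun_compose f(2) g(2)])
  then show ?thesis
    unfolding closure_sequential using assms(3)[OF f(1) g(1)]
    by (intro exI[of _ "\<lambda>n. f n o\<^sub>L g n"]) simp
qed

lemma blinfun_compose_id: "id_blinfun o\<^sub>L t = t" "t o\<^sub>L id_blinfun = t"
  by (rule blinfun_eqI; simp)+

lemma sum_blinfun_compose_left: "(\<Sum>i\<in>I. f i) o\<^sub>L t = (\<Sum>i\<in>I. f i o\<^sub>L t)"
  by (rule blinfun_eqI) (simp add: blinfun.sum_left)

lemma sum_blinfun_compose_right: "t o\<^sub>L (\<Sum>i\<in>I. f i) = (\<Sum>i\<in>I. t o\<^sub>L f i)"
  by (rule blinfun_eqI) (simp add: blinfun.sum_left blinfun.sum_right)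

lemma bounded_operators_add:
  "s \<in> bounded_operators \<Longrightarrow> t \<in> bounded_operators \<Longrightarrow> s + t \<in> bounded_operators"
  by (simp add: bounded_operators_def blinfun.bilinear_simps scaleC_add_right)

lemma bounded_operators_zero: "0 \<in> bounded_operators"
  by (simp add: bounded_operators_def)

lemma bounded_operators_compose:
  "s \<in> bounded_operators \<Longrightarrow> t \<in> bounded_operators \<Longrightarrow> s o\<^sub>L t \<in> bounded_operators"
  by (simp add: bounded_operators_def)

text \<open>A scalar moves, conjugated, to the test vector, so complex linearity becomes a relation
  between convergent matrix coefficients.\<close>

lemma bounded_operators_weak_limit:
  assumes "F \<noteq> bot" and a: "\<And>i. a i \<in> bounded_operators"
    and lim: "\<And>x y. ((\<lambda>i. inner x (blinfun_apply (a i) y)) \<longlongrightarrow> inner x (blinfun_apply b y)) F"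
  shows "b \<in> bounded_operators"
proof -
  have "b (c *\<^sub>C y) = c *\<^sub>C b y" for c y
  proof (subst vector_eq_ldot[symmetric], rule allI)
    fix x
    have "inner x (a i (c *\<^sub>C y)) = inner (cnj c *\<^sub>C x) (a i y)" for i
      using a[of i] by (simp add: bounded_operators_def inner_scaleC_right)
    then have "((\<lambda>i. inner x (a i (c *\<^sub>C y))) \<longlongrightarrow> inner (cnj c *\<^sub>C x) (b y)) F"
      using lim by simp
    then show "inner x (b (c *\<^sub>C y)) = inner x (c *\<^sub>C b y)"
      unfolding inner_scaleC_right[of x c "b y"] using tendsto_unique[OF \<open>F \<noteq> bot\<close> lim] by blast
  qed
  then show ?thesis by (simp add: bounded_operators_def)
qed

lemma closed_bounded_operators:
  "closed (bounded_operators :: ('a::complex_hilbert_space \<Rightarrow>\<^sub>L 'a) set)"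
proof -
  have "bounded_operators =
      (\<Inter>c. \<Inter>x. {t. blinfun_apply t (c *\<^sub>C x) = c *\<^sub>C blinfun_apply t (x :: 'a)})"
    by (auto simp: bounded_operators_def)
  also have "closed \<dots>"
    by (intro closed_INT ballI closed_Collect_eq continuous_intros
        bounded_linear.continuous_on[OF bounded_linear_scaleC_right])
  finally show ?thesis .
qed

lemma orthogonal_projection_bounded_operator:
  "orthogonal_projection p \<Longrightarrow> p \<in> bounded_operators"
  by (simp add: orthogonal_projection_def)

lemma orthogonal_projection_idem:
  "orthogonal_projection p \<Longrightarrow> blinfun_apply p (blinfun_apply p x) = blinfun_apply p x"
  unfolding orthogonal_projection_def by (metis blinfun_apply_blinfun_compose)

lemma orthogonal_projection_inner:
  "orthogonal_projection p \<Longrightarrow> inner (blinfun_apply p x) y = inner x (blinfun_apply p y)"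
  unfolding orthogonal_projection_def by (metis Re_cinner)

lemma norm_orthogonal_projection_le:
  assumes "orthogonal_projection p"
  shows "norm p \<le> 1"
proof (rule norm_blinfun_bound)
  fix x
  have "norm (p x) * norm (p x) = inner x (p x)"
    using orthogonal_projection_inner[OF assms, of x "p x"]
    by (simp add: orthogonal_projection_idem[OF assms] flip: power2_eq_square power2_norm_eq_inner)
  also have "\<dots> \<le> norm x * norm (p x)" by (rule norm_cauchy_schwarz)
  finally show "norm (p x) \<le> 1 * norm x"
    by (cases "norm (p x) = 0") (auto simp: mult_le_cancel_right)
qed simp

lemma norm_compose_projection_le:
  assumes "orthogonal_projection p"
  shows "norm (t o\<^sub>L p) \<le> norm t" and "norm (p o\<^sub>L t) \<le> norm t"
proof -
  have p: "norm p \<le> 1" by (rule norm_orthogonal_projection_le[OF assms])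
  show "norm (t o\<^sub>L p) \<le> norm t"
    using norm_blinfun_compose[of t p] mult_left_mono[OF p norm_ge_zero[of t]] by simp
  show "norm (p o\<^sub>L t) \<le> norm t"
    using norm_blinfun_compose[of p t] mult_right_mono[OF p norm_ge_zero[of t]] by simp
qed

lemma orthogonal_projection_zero: "orthogonal_projection 0"
  using cinner_commute[of _ 0]
  by (auto simp: orthogonal_projection_def bounded_operators_zero blinfun_compose_bilinear_simps)

text \<open>One order of the product is enough, because \<open>q o\<^sub>L p\<close> is the adjoint
  of \<open>p o\<^sub>L q\<close>.\<close>

lemma orthogonal_projection_add:
  assumes p: "orthogonal_projection p" and q: "orthogonal_projection q"
    and pq: "p o\<^sub>L q = 0"
  shows "orthogonal_projection (p + q)"
proof -
  have "q (p x) = 0" for x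
  proof -
    have "inner y (q (p x)) = inner (p (q y)) x" for y
      by (simp add: orthogonal_projection_inner[OF p] orthogonal_projection_inner[OF q])
    moreover have "p (q y) = 0" for y
      using pq by (metis blinfun_apply_blinfun_compose zero_blinfun.rep_eq)
    ultimately have "inner (q (p x)) (q (p x)) = 0" by simp
    then show ?thesis by simp
  qed
  then have "q o\<^sub>L p = 0" by (intro blinfun_eqI) simp
  then have "(p + q) o\<^sub>L (p + q) = p + q"
    using p q pq by (simp add: blinfun_compose_bilinear_simps orthogonal_projection_def)
  moreover have "cinner ((p + q) x) y = cinner x ((p + q) y)" for x y
  proof -
    have "cinner (u + v) y = cinner u y + cinner v y" for u v
      using arg_cong[where f = cnj, OF cinner_add_right[of y u v]]
      by (simp flip: cinner_commute)
    then show ?thesis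
      using p q by (simp add: orthogonal_projection_def blinfun.add_left cinner_add_right)
  qed
  ultimately show ?thesis
    using bounded_operators_add[of p q] p q by (simp add: orthogonal_projection_def)
qed

lemma orthogonal_projection_sum:
  assumes "finite I" and "\<And>i. i \<in> I \<Longrightarrow> orthogonal_projection (p i)"
    and "\<And>i j. i \<in> I \<Longrightarrow> j \<in> I \<Longrightarrow> i \<noteq> j \<Longrightarrow> p i o\<^sub>L p j = 0"
  shows "orthogonal_projection (\<Sum>i\<in>I. p i)"
  using assms
proof (induction I rule: finite_induct)
  case (insert i I)
  have "p i o\<^sub>L (\<Sum>j\<in>I. p j) = (\<Sum>j\<in>I. p i o\<^sub>L p j)"
    by (rule bounded_linear.linear[THEN linear_sum]) (intro bounded_linear_intros)
  also have "\<dots> = 0" using insert by (intro sum.neutral) auto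
  finally have "p i o\<^sub>L (\<Sum>j\<in>I. p j) = 0" .
  moreover have "orthogonal_projection (\<Sum>j\<in>I. p j)" using insert by simp
  ultimately show ?case using insert by (simp add: orthogonal_projection_add)
qed (simp add: orthogonal_projection_zero)

subsection \<open>Compact operators\<close>

lemma compact_closure_subset:
  fixes K :: "'a::metric_space set"
  assumes "compact K" and "S \<subseteq> K"
  shows "compact (closure S)"
proof -
  have "closure S \<subseteq> K" using assms by (intro closure_minimal compact_imp_closed)
  then have "closure S = K \<inter> closure S" by blast
  then show ?thesis using compact_Int_closed[OF assms(1) closed_closure[of S]] by simp
qed

text \<open>In a complete space relative compactness is total boundedness; halving the radius leaves
  room for the passage to the closure. In this form compactness is easy to perturb.\<close>

lemma compact_closure_iff:
  fixes S :: "'a::{real_normed_vector, complete_space} set"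
  shows "compact (closure S) \<longleftrightarrow> (\<forall>e>0. \<exists>k. finite k \<and> S \<subseteq> (\<Union>x\<in>k. ball x e))"
proof
  assume "compact (closure S)"
  then show "\<forall>e>0. \<exists>k. finite k \<and> S \<subseteq> (\<Union>x\<in>k. ball x e)"
    unfolding compact_eq_totally_bounded using closure_subset[of S] by (meson order_trans)
next
  assume *: "\<forall>e>0. \<exists>k. finite k \<and> S \<subseteq> (\<Union>x\<in>k. ball x e)"
  have "\<exists>k. finite k \<and> closure S \<subseteq> (\<Union>x\<in>k. ball x e)" if "e > 0" for e
  proof -
    obtain k where k: "finite k" "S \<subseteq> (\<Union>x\<in>k. ball x (e/2))"
      using *[rule_format, of "e/2"] \<open>e > 0\<close> by auto
    have "(\<Union>x\<in>k. ball x (e/2)) \<subseteq> (\<Union>x\<in>k. cball x (e/2))"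
      by (intro UN_mono ball_subset_cball order_refl)
    with k have "closure S \<subseteq> (\<Union>x\<in>k. cball x (e/2))"
      by (intro closure_minimal closed_UN) auto
    also have "\<dots> \<subseteq> (\<Union>x\<in>k. ball x e)" using \<open>e > 0\<close> by (intro UN_mono) auto
    finally show ?thesis using k(1) by blast
  qed
  then show "compact (closure S)"
    unfolding compact_eq_totally_bounded by (simp add: complete_eq_closed)
qed

lemma compact_operator_iff:
  "compact_operator t \<longleftrightarrow> t \<in> bounded_operators \<and>
     (\<forall>e>0. \<exists>k. finite k \<and> blinfun_apply t ` cball 0 1 \<subseteq> (\<Union>x\<in>k. ball x e))"
  unfolding compact_operator_def compact_closure_iff ..

lemma compact_operator_zero: "compact_operator 0"
proof -
  have "(0 :: 'a \<Rightarrow>\<^sub>L 'a) ` cball 0 1 \<subseteq> {0}" by auto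
  then have "closure ((0 :: 'a \<Rightarrow>\<^sub>L 'a) ` cball 0 1) \<subseteq> {0}"
    by (intro closure_minimal) auto
  then have "finite (closure ((0 :: 'a \<Rightarrow>\<^sub>L 'a) ` cball 0 1))"
    by (rule finite_subset) simp
  then show ?thesis
    by (simp add: compact_operator_def bounded_operators_zero finite_imp_compact)
qed

lemma compact_operator_compose_left:
  assumes "s \<in> bounded_operators" and t: "compact_operator t"
  shows "compact_operator (s o\<^sub>L t)"
proof -
  let ?K = "closure (t ` cball 0 1)"
  have K: "compact (s ` ?K)"
    using t by (intro compact_continuous_image continuous_intros) (simp add: compact_operator_def)
  have "(s o\<^sub>L t) ` cball 0 1 \<subseteq> s ` ?K"
    using closure_subset[of "t ` cball 0 1"] by auto
  then have "compact (closure ((s o\<^sub>L t) ` cball 0 1))" by (rule compact_closure_subset[OF K])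
  then show ?thesis
    using assms by (simp add: compact_operator_def bounded_operators_compose)
qed

lemma compact_operator_compose_right:
  assumes t: "compact_operator t" and "s \<in> bounded_operators"
  shows "compact_operator (t o\<^sub>L s)"
proof -
  \<comment> \<open>Adding 1 keeps the scaling factor positive even for
    \<open>s = 0\<close>.\<close>
  define c where "c = norm s + 1"
  have "c > 0" by (simp add: c_def add_nonneg_pos)
  let ?K = "(*\<^sub>R) c ` closure (t ` cball 0 1)"
  have K: "compact ?K"
    using t by (intro compact_scaling) (simp add: compact_operator_def)
  have "(t o\<^sub>L s) ` cball 0 1 \<subseteq> ?K"
  proof clarsimp
    fix x :: 'a assume "norm x \<le> 1"
    have "norm (s x) \<le> norm s * norm x" by (rule norm_blinfun)
    also have "\<dots> \<le> norm s" using \<open>norm x \<le> 1\<close> by (simp add: mult_left_le)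
    finally have "(1 / c) *\<^sub>R s x \<in> cball 0 1" using \<open>c > 0\<close> by (simp add: c_def field_simps)
    then have "t ((1 / c) *\<^sub>R s x) \<in> closure (t ` cball 0 1)"
      by (meson closure_subset imageI subsetD)
    moreover have "t (s x) = c *\<^sub>R t ((1 / c) *\<^sub>R s x)"
      using \<open>c > 0\<close> by (simp add: blinfun.scaleR_right)
    ultimately show "t (s x) \<in> ?K" by blast
  qed
  then have "compact (closure ((t o\<^sub>L s) ` cball 0 1))" by (rule compact_closure_subset[OF K])
  then show ?thesis
    using assms by (simp add: compact_operator_def bounded_operators_compose)
qed

lemma compact_operator_add:
  assumes s: "compact_operator s" and t: "compact_operator t"
  shows "compact_operator (s + t)"
proof -
  let ?K = "{x + y |x y. x \<in> closure (s ` cball 0 1) \<and> y \<in> closure (t ` cball 0 1)}"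
  have K: "compact ?K" using s t by (intro compact_sums) (simp_all add: compact_operator_def)
  have "(s + t) ` cball 0 1 \<subseteq> ?K"
    using closure_subset[of "s ` cball 0 1"] closure_subset[of "t ` cball 0 1"]
    by (fastforce simp: blinfun.add_left)
  then have "compact (closure ((s + t) ` cball 0 1))" by (rule compact_closure_subset[OF K])
  then show ?thesis
    using assms by (simp add: compact_operator_def bounded_operators_add)
qed

lemma compact_operator_sum:
  "(\<And>i. i \<in> I \<Longrightarrow> compact_operator (t i)) \<Longrightarrow> compact_operator (\<Sum>i\<in>I. t i)"
  by (induction I rule: infinite_finite_induct)
    (auto intro: compact_operator_add compact_operator_zero)

text \<open>A finite \<open>e/2\<close>-net for the image of the unit ball under a compact operator
  within \<open>e/2\<close> of \<open>t\<close> is an \<open>e\<close>-net for its image under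
  \<open>t\<close>.\<close>

lemma closed_compact_operators: "closed {t :: 'a::complex_hilbert_space \<Rightarrow>\<^sub>L 'a. compact_operator t}"
proof -
  have "compact_operator t"
    if t: "t \<in> closure {t :: 'a::complex_hilbert_space \<Rightarrow>\<^sub>L 'a. compact_operator t}" for t
    unfolding compact_operator_iff
  proof (intro conjI allI impI)
    have "closure {t :: 'a \<Rightarrow>\<^sub>L 'a. compact_operator t} \<subseteq> bounded_operators"
      by (rule closure_minimal[OF _ closed_bounded_operators]) (auto simp: compact_operator_def)
    then show "t \<in> bounded_operators" using t by blast
    fix e :: real assume "e > 0"
    then obtain s :: "'a \<Rightarrow>\<^sub>L 'a" where s: "compact_operator s" "dist s t < e / 2"
      using t unfolding closure_approachable by (metis half_gt_zero mem_Collect_eq)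
    then obtain k where k: "finite k" "s ` cball 0 1 \<subseteq> (\<Union>x\<in>k. ball x (e/2))"
      using \<open>e > 0\<close> unfolding compact_operator_iff by (metis half_gt_zero)
    have "t ` cball 0 1 \<subseteq> (\<Union>x\<in>k. ball x e)"
    proof clarsimp
      fix v :: 'a assume v: "norm v \<le> 1"
      then have "s v \<in> (\<Union>x\<in>k. ball x (e/2))" by (intro subsetD[OF k(2)]) simp
      then obtain x where x: "x \<in> k" "dist x (s v) < e/2" by auto
      have "dist (s v) (t v) \<le> norm (s - t) * norm v"
        unfolding dist_norm using norm_blinfun[of "s - t" v] by (simp add: blinfun.diff_left)
      also have "\<dots> \<le> dist s t" using v by (simp add: dist_norm mult_left_le)
      finally show "\<exists>x\<in>k. dist x (t v) < e"
        using x s(2) dist_triangle[of x "t v" "s v"] by (intro bexI[of _ x]) auto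
    qed
    then show "\<exists>k. finite k \<and> t ` cball 0 1 \<subseteq> (\<Union>x\<in>k. ball x e)" using k(1) by blast
  qed
  then show ?thesis by (metis closure_subset_eq mem_Collect_eq subsetI)
qed

lemma rank_one_projection:
  assumes "norm w = 1"
  obtains p :: "'h::complex_hilbert_space \<Rightarrow>\<^sub>L 'h"
  where "orthogonal_projection p" and "compact_operator p"
    and "\<And>x. blinfun_apply p x = cinner w x *\<^sub>C w"
proof -
  let ?p = "\<lambda>x. cinner w x *\<^sub>C w"
  define p where "p = Blinfun ?p"
  have "bounded_linear ?p"
    using bounded_linear_compose[OF bounded_linear_scaleC_left bounded_linear_cinner] .
  then have p: "blinfun_apply p x = cinner w x *\<^sub>C w" for x
    by (simp add: p_def bounded_linear_Blinfun_apply)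
  have w: "cinner w w = 1" using assms by (simp add: cinner_self)
  have "orthogonal_projection p"
    unfolding orthogonal_projection_def
  proof (intro conjI allI)
    show "p \<in> bounded_operators"
      by (simp add: bounded_operators_def p cinner_scaleC_right scaleC_scaleC)
    show "p o\<^sub>L p = p" by (rule blinfun_eqI) (simp add: p cinner_scaleC_right w)
    show "cinner (p x) y = cinner x (p y)" for x y
      using cinner_commute[of x w] by (simp add: p cinner_scaleC_left cinner_scaleC_right)
  qed
  moreover have "compact_operator p"
  proof -
    let ?K = "(\<lambda>c. c *\<^sub>C w) ` cball 0 1"
    have K: "compact ?K"
      by (intro compact_continuous_image bounded_linear.continuous_on[OF bounded_linear_scaleC_left]
          continuous_intros) simp
    have "p ` cball 0 1 \<subseteq> ?K"
    proof clarsimp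
      fix x :: 'h assume "norm x \<le> 1"
      have "cmod (cinner w x) = norm (p x)" using assms by (simp add: p norm_scaleC)
      also have "\<dots> \<le> norm p * norm x" by (rule norm_blinfun)
      also have "\<dots> \<le> 1"
        using norm_orthogonal_projection_le[OF \<open>orthogonal_projection p\<close>] \<open>norm x \<le> 1\<close>
        by (simp add: mult_le_one)
      finally show "p x \<in> ?K" by (simp add: p)
    qed
    then have "compact (closure (p ` cball 0 1))" by (rule compact_closure_subset[OF K])
    then show ?thesis
      using \<open>orthogonal_projection p\<close> by (simp add: compact_operator_def orthogonal_projection_def)
  qed
  ultimately show thesis using p that by blast
qed

text \<open>Gram-Schmidt, one vector at a time: a vector not yet fixed by \<open>q\<close>
  contributes the rank one projection onto its normalised component \<open>w\<close> orthogonal to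
  the range of \<open>q\<close>. Since \<open>w\<close> stays in the range of \<open>p\<close>, the
  result stays below \<open>p\<close>.\<close>

lemma compact_projection_onto_finite:
  fixes p :: "'h::complex_hilbert_space \<Rightarrow>\<^sub>L 'h"
  assumes "orthogonal_projection p" and "finite S" and "S \<subseteq> range (blinfun_apply p)"
  obtains q where "orthogonal_projection q" and "compact_operator q"
    and "p o\<^sub>L q = q" and "q o\<^sub>L p = q" and "\<And>v. v \<in> S \<Longrightarrow> blinfun_apply q v = v"
proof -
  have "\<exists>q. orthogonal_projection q \<and> compact_operator q \<and> p o\<^sub>L q = q \<and> q o\<^sub>L p = q \<and>
      (\<forall>v\<in>S. blinfun_apply q v = v)"
    using \<open>finite S\<close> \<open>S \<subseteq> _\<close>
  proof (induction S rule: finite_induct)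
    case empty
    show ?case
      by (rule exI[of _ 0]) (simp add: orthogonal_projection_zero compact_operator_zero
          blinfun_compose_bilinear_simps)
  next
    case (insert v S)
    then obtain q where q: "orthogonal_projection q" "compact_operator q" "p o\<^sub>L q = q"
        "q o\<^sub>L p = q" and qS: "\<forall>v\<in>S. q v = v" by auto
    have pv: "p v = v" using insert.prems orthogonal_projection_idem[OF assms(1)] by auto
    show ?case
    proof (cases "q v = v")
      case True
      then show ?thesis using q qS by auto
    next
      case False
      define w where "w = (1 / norm (v - q v)) *\<^sub>R (v - q v)"
      have "norm w = 1" using False by (simp add: w_def)
      then obtain e :: "'h \<Rightarrow>\<^sub>L 'h" where e: "orthogonal_projection e" "compact_operator e"
          "\<And>x. e x = cinner w x *\<^sub>C w" by (rule rank_one_projection) blast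
      have qw: "q w = 0"
        using orthogonal_projection_idem[OF q(1)]
        by (simp add: w_def blinfun.scaleR_right blinfun.diff_right)
      have pq: "p (q x) = q x" and qp: "q (p x) = q x" for x
        using q(3,4) by (metis blinfun_apply_blinfun_compose)+
      have pw: "p w = w"
        by (simp add: w_def blinfun.scaleR_right blinfun.diff_right pv pq)
      have lin: "b (c *\<^sub>C x) = c *\<^sub>C b x" if "orthogonal_projection b"
        for b :: "'h \<Rightarrow>\<^sub>L 'h" and c x
        using that by (simp add: orthogonal_projection_def bounded_operators_def)
      have cw: "cinner w (b x) = cinner (b w) x" if "orthogonal_projection b"
        for b :: "'h \<Rightarrow>\<^sub>L 'h" and x
        using that by (simp add: orthogonal_projection_def)
      have "q o\<^sub>L e = 0" by (rule blinfun_eqI) (simp add: e lin[OF q(1)] qw)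
      then have "orthogonal_projection (q + e)" by (intro orthogonal_projection_add q e)
      moreover have "p o\<^sub>L (q + e) = q + e"
        by (rule blinfun_eqI)
          (simp add: blinfun.add_left blinfun.add_right e(3) lin[OF assms(1)] pw pq)
      moreover have "(q + e) o\<^sub>L p = q + e"
        by (rule blinfun_eqI) (simp add: blinfun.add_left e(3) cw[OF assms(1)] pw qp)
      \<comment> \<open>Vectors fixed earlier lie in the range of \<open>q\<close>, to which
        \<open>w\<close> is orthogonal, so \<open>e\<close> kills them.\<close>
      moreover have "(q + e) u = u" if "u \<in> S" for u
      proof -
        have "e u = cinner w (q u) *\<^sub>C w" using qS that by (simp add: e)
        also have "\<dots> = 0" by (simp add: cw[OF q(1)] qw)
        finally show ?thesis using qS that by (simp add: blinfun.add_left)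
      qed
      moreover have "(q + e) v = v"
      proof -
        have "e (q v) = 0"
          by (simp add: e cw[OF q(1)] qw)
        moreover have "e (v - q v) = v - q v"
        proof -
          have "v - q v = norm (v - q v) *\<^sub>R w" using False by (simp add: w_def)
          moreover have "e w = w"
            using \<open>norm w = 1\<close> by (simp add: e cinner_self)
          ultimately show ?thesis by (metis blinfun.scaleR_right)
        qed
        ultimately show ?thesis by (simp add: blinfun.add_left blinfun.diff_right)
      qed
      ultimately show ?thesis
        using compact_operator_add[OF q(2) e(2)] by blast
    qed
  qed
  then show thesis using that by blast
qed

section \<open>Locally finite discrete modules\<close>

lemma (in extended_metric_space) dist_le_diam: "x \<in> A \<Longrightarrow> y \<in> A \<Longrightarrow> d x y \<le> diam A"
  unfolding diam_def by (meson SUP_upper2 SUP_upper)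

lemma (in extended_metric_space) diam_le: "(\<And>x y. x \<in> A \<Longrightarrow> y \<in> A \<Longrightarrow> d x y \<le> r) \<Longrightarrow> diam A \<le> r"
  unfolding diam_def by (intro SUP_least)

lemma (in extended_metric_space) dist_triangle4:
  assumes "x \<in> X" "x' \<in> X" "y' \<in> X" "y \<in> X"
  shows "d x y \<le> d x x' + d x' y' + d y' y"
  using dist_triangle[of x y' y] dist_triangle[of x x' y'] assms
  by (meson add_right_mono order_trans)

context X_module
begin

sublocale measurable: algebra X \<AA>
  by (rule measurable_algebra)

lemmas measurable_subset = measurable.sets_into_space
  and measurable_empty = measurable.empty_sets
  and measurable_Compl = measurable.compl_sets

lemma P_empty: "P {} = 0"
  using P_Un[OF measurable_empty measurable_empty] by simp

lemma P_bounded: "A \<in> \<AA> \<Longrightarrow> P A \<in> bounded_operators"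
  using projection orthogonal_projection_bounded_operator by blast

lemma P_disjoint: "A \<in> \<AA> \<Longrightarrow> B \<in> \<AA> \<Longrightarrow> A \<inter> B = {} \<Longrightarrow> P A o\<^sub>L P B = 0"
  using P_Int P_empty by metis

lemma P_absorb: "A \<in> \<AA> \<Longrightarrow> B \<in> \<AA> \<Longrightarrow> A \<subseteq> B \<Longrightarrow> P A o\<^sub>L P B = P A \<and> P B o\<^sub>L P A = P A"
  using P_Int[of A B] P_Int[of B A] by (simp add: Int_absorb1 Int_absorb2)

lemma P_commute: "A \<in> \<AA> \<Longrightarrow> B \<in> \<AA> \<Longrightarrow> P A o\<^sub>L P B = P B o\<^sub>L P A"
  by (metis P_Int Int_commute)

lemma P_Compl: "A \<in> \<AA> \<Longrightarrow> P (X - A) = id_blinfun - P A"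
  using P_Un[of A "X - A"] measurable_Compl[of A] measurable_subset[of A] P_X
  by (simp add: Un_absorb1 eq_diff_eq add.commute)

section \<open>Propagation and its stability\<close>

lemma propagation_mono: "propagation_at_most t r \<Longrightarrow> r \<le> s \<Longrightarrow> propagation_at_most t s"
  unfolding propagation_at_most_def by (meson order_le_less_trans)

lemma finite_propagation_nat:
  assumes "finite_propagation t"
  shows "\<exists>n::nat. propagation_at_most t (of_nat n)"
proof -
  obtain r where "r < \<infinity>" "propagation_at_most t r"
    using assms finite_propagation_def by blast
  moreover then obtain n where "r < of_nat n"
    using ennreal_Ex_less_of_nat by auto
  ultimately show ?thesis using propagation_mono less_imp_le by blast
qed

lemma propagation_zero: "propagation_at_most 0 r"
  by (simp add: propagation_at_most_def blinfun_compose_bilinear_simps)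

lemma propagation_add:
  "propagation_at_most s r \<Longrightarrow> propagation_at_most t r \<Longrightarrow> propagation_at_most (s + t) r"
  by (simp add: propagation_at_most_def blinfun_compose_bilinear_simps)

text \<open>\<open>P B\<close> commutes with every \<open>P A\<close>, so the bound does not grow,
  in contrast to a product of two general operators.\<close>

lemma propagation_compose_P:
  assumes "propagation_at_most t r" and "B \<in> \<AA>"
  shows "propagation_at_most (t o\<^sub>L P B) r"
  unfolding propagation_at_most_def
proof (intro ballI impI)
  fix A A' assume "A \<in> \<AA>" "A' \<in> \<AA>" "\<forall>a\<in>A. \<forall>a'\<in>A'. r < d a' a"
  then have "(P A' o\<^sub>L t o\<^sub>L P A) o\<^sub>L P B = 0"
    using assms(1) by (simp add: propagation_at_most_def blinfun_compose_bilinear_simps)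
  then show "P A' o\<^sub>L (t o\<^sub>L P B) o\<^sub>L P A = 0"
    using P_commute[OF \<open>A \<in> \<AA>\<close> \<open>B \<in> \<AA>\<close>] by (simp add: blinfun_compose_assoc)
qed

text \<open>Each vanishing block is a family of linear equations in the matrix coefficients, once
  \<open>P A'\<close> has been moved to the test vector.\<close>

lemma propagation_weak_limit:
  assumes "F \<noteq> bot" and a: "\<And>i. propagation_at_most (a i) r"
    and lim: "\<And>x y. ((\<lambda>i. inner x (blinfun_apply (a i) y)) \<longlongrightarrow> inner x (blinfun_apply b y)) F"
  shows "propagation_at_most b r"
  unfolding propagation_at_most_def
proof (intro ballI impI)
  fix A A' assume A: "A \<in> \<AA>" "A' \<in> \<AA>" "\<forall>a\<in>A. \<forall>a'\<in>A'. r < d a' a"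
  have "inner x (P A' (b (P A y))) = 0" for x y
  proof -
    have "P A' (a i (P A y)) = 0" for i
      using a[of i] A unfolding propagation_at_most_def
      by (metis blinfun_apply_blinfun_compose zero_blinfun.rep_eq)
    then have "inner (P A' x) (a i (P A y)) = 0" for i
      using orthogonal_projection_inner[OF projection[OF A(2)]] by simp
    then have "((\<lambda>i. 0) \<longlongrightarrow> inner (P A' x) (b (P A y))) F"
      using lim[of "P A' x" "P A y"] by simp
    then have "inner (P A' x) (b (P A y)) = 0"
      using tendsto_unique[OF \<open>F \<noteq> bot\<close> _ tendsto_const] by blast
    then show ?thesis using orthogonal_projection_inner[OF projection[OF A(2)]] by simp
  qed
  then have "P A' (b (P A y)) = 0" for y using inner_eq_zero_iff by blast
  then show "P A' o\<^sub>L b o\<^sub>L P A = 0" by (intro blinfun_eqI) simp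
qed

section \<open>The norm closures of the operators of finite propagation\<close>

lemma C_cp_approx:
  assumes "t \<in> C_cp" and "e > 0"
  obtains a n where "a \<in> bounded_operators" and "propagation_at_most a (of_nat n)"
    and "norm (t - a) < e"
proof -
  obtain a where "a \<in> bounded_operators" "finite_propagation a" "dist a t < e"
    using assms unfolding C_cp_def closure_approachable by blast
  moreover from this(2) obtain n where "propagation_at_most a (of_nat n)"
    using finite_propagation_nat by blast
  ultimately show thesis
    using that by (simp add: dist_norm norm_minus_commute)
qed

text \<open>Meant for use by contraposition: an operator outside \<open>C_cp\<close> has distance
  bounded below by one positive \<open>e\<close> from all of \<open>C_cp\<close>.\<close>

lemma C_cp_memI:
  assumes "\<And>e. e > 0 \<Longrightarrow> \<exists>a\<in>C_cp. norm (t - a) \<le> e"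
  shows "t \<in> C_cp"
proof -
  have "\<exists>a\<in>C_cp. dist a t < e" if "e > 0" for e
    using assms[of "e/2"] that by (force simp: dist_norm norm_minus_commute)
  then have "t \<in> closure C_cp" by (simp add: closure_approachable)
  then show ?thesis by (simp add: C_cp_def)
qed

lemma C_cp_I: "t \<in> bounded_operators \<Longrightarrow> propagation_at_most t r \<Longrightarrow> r < \<infinity> \<Longrightarrow> t \<in> C_cp"
  unfolding C_cp_def finite_propagation_def by (rule subsetD[OF closure_subset]) blast

lemma C_cp_add:
  assumes "s \<in> C_cp" "t \<in> C_cp"
  shows "s + t \<in> C_cp"
proof -
  let ?S = "{t \<in> bounded_operators. finite_propagation t}"
  have sum: "a + b \<in> ?S" if ab: "a \<in> ?S" "b \<in> ?S" for a b
  proof -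
    obtain m n where "propagation_at_most a (of_nat m)" "propagation_at_most b (of_nat n)"
      using ab finite_propagation_nat by blast
    then have "propagation_at_most (a + b) (max (of_nat m) (of_nat n))"
      by (intro propagation_add) (erule propagation_mono, simp)+
    moreover have "max (of_nat m) (of_nat n) < (\<infinity> :: ennreal)"
      by (simp add: of_nat_less_top)
    ultimately have "finite_propagation (a + b)"
      unfolding finite_propagation_def by blast
    then show ?thesis using ab bounded_operators_add by blast
  qed
  obtain f g where f: "\<And>n. f n \<in> ?S" "f \<longlonglongrightarrow> s" and g: "\<And>n. g n \<in> ?S" "g \<longlonglongrightarrow> t"
    using assms unfolding C_cp_def closure_sequential by blast
  have "(\<lambda>n. f n + g n) \<longlonglongrightarrow> s + t" by (rule tendsto_add[OF f(2) g(2)])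
  then show ?thesis
    unfolding C_cp_def closure_sequential using sum[OF f(1) g(1)]
    by (intro exI[of _ "\<lambda>n. f n + g n"]) blast
qed

lemma C_cp_sum: "(\<And>i. i \<in> I \<Longrightarrow> f i \<in> C_cp) \<Longrightarrow> (\<Sum>i\<in>I. f i) \<in> C_cp"
proof (induction I rule: infinite_finite_induct)
  case empty
  then show ?case
    using C_cp_I[OF bounded_operators_zero propagation_zero, of 0] by simp
next
  case (infinite I)
  then show ?case
    using C_cp_I[OF bounded_operators_zero propagation_zero, of 0] by simp
qed (auto intro: C_cp_add)

lemma C_cp_subset_bounded: "C_cp \<subseteq> bounded_operators"
  unfolding C_cp_def by (intro closure_minimal closed_bounded_operators) blast

lemma C_Roe_subset_C_cp: "C_Roe \<subseteq> C_cp"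
  unfolding C_cp_def C_Roe_def by (intro closure_mono) blast

text \<open>Local compactness survives the norm closure because compact operators are norm closed;
  the contradiction for columns rests on this.\<close>

lemma C_Roe_compact:
  assumes "s \<in> C_Roe" and "A \<in> \<AA>" and "diam A < \<infinity>"
  shows "compact_operator (s o\<^sub>L P A)"
proof -
  have "continuous_on UNIV (\<lambda>s. s o\<^sub>L P A)" by (intro continuous_intros)
  then have "closed {s. compact_operator (s o\<^sub>L P A)}"
    using closed_vimage[OF closed_compact_operators, of "\<lambda>s. s o\<^sub>L P A"] by (simp add: vimage_def)
  then have "C_Roe \<subseteq> {s. compact_operator (s o\<^sub>L P A)}"
    unfolding C_Roe_def using assms(2,3)
    by (intro closure_minimal) (auto simp: locally_compact_operator_def)
  then show ?thesis using assms(1) by blast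
qed

end

text \<open>The partition witnessing discreteness may cut a bounded set into infinitely many pieces.
  This locale fixes a partition for which that does not happen, with the other properties of
  discreteness retained.\<close>

locale locally_finite_module = X_module X d \<AA> P
  for X :: "'x set" and d and \<AA> and P :: "'x set \<Rightarrow> ('h::complex_hilbert_space \<Rightarrow>\<^sub>L 'h)" +
  fixes \<Q> :: "'x set set" and \<rho> :: ennreal
  assumes partition: "partition_on X \<Q>"
    and pieces_measurable: "\<Q> \<subseteq> \<AA>"
    and mesh_finite: "\<rho> < \<infinity>"
    and mesh: "A \<in> \<Q> \<Longrightarrow> diam A \<le> \<rho>"
    and P_has_sum: "((\<lambda>A. blinfun_apply (P A) x) has_sum x) \<Q>"
    and measurableI: "C \<subseteq> X \<Longrightarrow> (\<And>A. A \<in> \<Q> \<Longrightarrow> C \<inter> A \<in> \<AA>) \<Longrightarrow> C \<in> \<AA>"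
    and locally_finite: "C \<subseteq> X \<Longrightarrow> diam C < \<infinity> \<Longrightarrow> finite {A \<in> \<Q>. A \<inter> C \<noteq> {}}"
begin

section \<open>Unions of pieces, neighbourhoods, and the ideal property\<close>

lemma piece_measurable: "A \<in> \<Q> \<Longrightarrow> A \<in> \<AA>"
  using pieces_measurable by blast

lemma piece_disjoint: "A \<in> \<Q> \<Longrightarrow> B \<in> \<Q> \<Longrightarrow> A \<noteq> B \<Longrightarrow> A \<inter> B = {}"
  using partition_onD2[OF partition] by (simp add: pairwise_def disjnt_def)

lemma piece_P_disjoint: "A \<in> \<Q> \<Longrightarrow> B \<in> \<Q> \<Longrightarrow> A \<noteq> B \<Longrightarrow> P A o\<^sub>L P B = 0"
  by (simp add: P_disjoint piece_measurable piece_disjoint)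

text \<open>Infinite \<open>G\<close> is allowed: an algebra gives only finite unions, but the trace
  of the union on each piece is all or nothing, and \<open>measurableI\<close> glues.\<close>

lemma Union_measurable:
  assumes "G \<subseteq> \<Q>"
  shows "\<Union>G \<in> \<AA>"
proof (rule measurableI)
  show "\<Union>G \<subseteq> X" using assms measurable_subset piece_measurable by blast
  fix A assume "A \<in> \<Q>"
  then have "\<Union>G \<inter> A = (if A \<in> G then A else {})"
    using piece_disjoint assms by (auto simp: subset_iff)
  then show "\<Union>G \<inter> A \<in> \<AA>"
    using \<open>A \<in> \<Q>\<close> piece_measurable measurable_empty by simp
qed

lemma P_Union: "finite G \<Longrightarrow> G \<subseteq> \<Q> \<Longrightarrow> P (\<Union>G) = (\<Sum>A\<in>G. P A)"
proof (induction G rule: finite_induct)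
  case (insert A G)
  then have "A \<inter> \<Union>G = {}" using piece_disjoint by fastforce
  then show ?case
    using insert P_Un[of A "\<Union>G"] Union_measurable[of G] piece_measurable by simp
qed (simp add: P_empty)

text \<open>The metric neighbourhood may fail to be measurable, so it is replaced by a union of
  whole pieces. It can reach farther than \<open>r\<close>, but by at most the mesh \<rho>.\<close>

definition nbhd :: "'x set \<Rightarrow> ennreal \<Rightarrow> 'x set" where
  "nbhd A r = \<Union>{B \<in> \<Q>. \<exists>a\<in>A. \<exists>b\<in>B. d a b \<le> r}"

lemma nbhd_measurable: "nbhd A r \<in> \<AA>"
  unfolding nbhd_def by (rule Union_measurable) blast

lemma nbhd_near:
  assumes "x \<in> nbhd A r" "A \<subseteq> X"
  obtains a where "a \<in> A" and "d a x \<le> r + \<rho>"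
proof -
  obtain B a b where B: "B \<in> \<Q>" "x \<in> B" "b \<in> B" "a \<in> A" "d a b \<le> r"
    using assms(1) unfolding nbhd_def by blast
  then have "x \<in> X" "b \<in> X" "a \<in> X"
    using measurable_subset piece_measurable assms(2) by blast+
  then have "d a x \<le> d a b + d b x" by (intro dist_triangle)
  also have "d b x \<le> \<rho>"
    using dist_le_diam[OF B(3,2)] mesh[OF B(1)] by (rule order_trans)
  also have "d a b \<le> r" by (rule B)
  finally show thesis using that B(4) by (simp add: add_right_mono)
qed

lemma nbhd_far: "x \<in> X \<Longrightarrow> x \<notin> nbhd A r \<Longrightarrow> a \<in> A \<Longrightarrow> r < d a x"
  using partition_onD1[OF partition] unfolding nbhd_def by (auto simp: not_le[symmetric])

lemma nbhd_bounded:
  assumes "A \<subseteq> X" "diam A < \<infinity>" "r < \<infinity>"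
  shows "diam (nbhd A r) < \<infinity>"
proof -
  have "diam (nbhd A r) \<le> (r + \<rho>) + diam A + (r + \<rho>)"
  proof (rule diam_le)
    fix x y assume xy: "x \<in> nbhd A r" "y \<in> nbhd A r"
    obtain a where a: "a \<in> A" "d a x \<le> r + \<rho>" using nbhd_near[OF xy(1) assms(1)] .
    obtain b where b: "b \<in> A" "d b y \<le> r + \<rho>" using nbhd_near[OF xy(2) assms(1)] .
    have X: "x \<in> X" "y \<in> X" "a \<in> X" "b \<in> X"
      using xy a b assms(1) measurable_subset[OF nbhd_measurable] by blast+
    have "d x y \<le> d x a + d a b + d b y" using dist_triangle4 X by blast
    also have "\<dots> \<le> (r + \<rho>) + diam A + (r + \<rho>)"
      using a b dist_le_diam[of a A b] dist_commute[OF X(1,3)] by (intro add_mono) auto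
    finally show "d x y \<le> (r + \<rho>) + diam A + (r + \<rho>)" .
  qed
  also have "\<dots> < \<infinity>" using assms mesh_finite by (simp add: ennreal_add_less_top)
  finally show ?thesis .
qed

lemma propagation_nbhd:
  assumes t: "propagation_at_most t r" and A: "A \<in> \<AA>"
  shows "t o\<^sub>L P A = P (nbhd A r) o\<^sub>L t o\<^sub>L P A" and "P A o\<^sub>L t = P A o\<^sub>L t o\<^sub>L P (nbhd A r)"
proof -
  let ?C = "X - nbhd A r"
  have C: "?C \<in> \<AA>" by (simp add: nbhd_measurable measurable_Compl)
  have far: "r < d a x" "r < d x a" if "a \<in> A" "x \<in> ?C" for a x
    using that nbhd_far dist_commute measurable_subset[OF A] by (auto simp: subset_iff)
  have "P ?C o\<^sub>L t o\<^sub>L P A = 0" "P A o\<^sub>L t o\<^sub>L P ?C = 0"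
    using t A C far unfolding propagation_at_most_def by blast+
  then show "t o\<^sub>L P A = P (nbhd A r) o\<^sub>L t o\<^sub>L P A" "P A o\<^sub>L t = P A o\<^sub>L t o\<^sub>L P (nbhd A r)"
    unfolding P_Compl[OF nbhd_measurable]
    by (simp_all add: blinfun_compose_bilinear_simps blinfun_compose_id)
qed

text \<open>Everything \<open>s\<close> produces from \<open>A\<close> is supported on
  \<open>nbhd A r\<close>, whose projection can be inserted between the factors; its overshoot is
  the \<rho> in the bound.\<close>

lemma propagation_compose:
  assumes s: "propagation_at_most s r" and t: "propagation_at_most t r'"
  shows "propagation_at_most (t o\<^sub>L s) (r + \<rho> + r')"
  unfolding propagation_at_most_def
proof (intro ballI impI)
  fix A A' assume A: "A \<in> \<AA>" "A' \<in> \<AA>" and far: "\<forall>a\<in>A. \<forall>a'\<in>A'. r + \<rho> + r' < d a' a"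
  have "r' < d a' x" if x: "x \<in> nbhd A r" and a': "a' \<in> A'" for x a'
  proof (rule ccontr)
    assume "\<not> r' < d a' x"
    obtain a where a: "a \<in> A" "d a x \<le> r + \<rho>"
      using nbhd_near[OF x measurable_subset[OF A(1)]] .
    have X: "a' \<in> X" "x \<in> X" "a \<in> X"
      using x a' a A measurable_subset nbhd_measurable by blast+
    have "d a' a \<le> d a' x + d x a" by (rule dist_triangle[OF X])
    also have "\<dots> \<le> r' + (r + \<rho>)"
      using a(2) dist_commute[OF X(2,3)] \<open>\<not> r' < d a' x\<close> by (intro add_mono) auto
    finally show False using far a(1) a' by (metis add.commute not_le)
  qed
  then have "P A' o\<^sub>L t o\<^sub>L P (nbhd A r) = 0"
    using t A(2) nbhd_measurable unfolding propagation_at_most_def by blast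
  moreover have "P A' o\<^sub>L (t o\<^sub>L s) o\<^sub>L P A = (P A' o\<^sub>L t o\<^sub>L P (nbhd A r)) o\<^sub>L (s o\<^sub>L P A)"
    using propagation_nbhd(1)[OF s A(1)] by (metis blinfun_compose_assoc)
  ultimately show "P A' o\<^sub>L (t o\<^sub>L s) o\<^sub>L P A = 0"
    by (simp add: blinfun_compose_bilinear_simps)
qed

lemma finite_propagation_compose:
  assumes "finite_propagation s" and "finite_propagation t"
  shows "finite_propagation (s o\<^sub>L t)"
proof -
  obtain r r' where "propagation_at_most t r" "propagation_at_most s r'" "r < \<infinity>" "r' < \<infinity>"
    using assms unfolding finite_propagation_def by blast
  then show ?thesis
    unfolding finite_propagation_def using propagation_compose mesh_finite
    by (intro exI[of _ "r + \<rho> + r'"]) (simp add: ennreal_add_less_top)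
qed

text \<open>Two of the four corners are a compact corner of \<open>s\<close> times a bounded
  operator. In the other two \<open>t\<close> stands next to \<open>P A\<close>; inserting the
  projection of the bounded set \<open>nbhd A r\<close> on its far side produces a compact corner of
  \<open>s\<close> again.\<close>

lemma locally_compact_compose:
  assumes s: "locally_compact_operator s" and t: "finite_propagation t" "t \<in> bounded_operators"
  shows "locally_compact_operator (t o\<^sub>L s)" and "locally_compact_operator (s o\<^sub>L t)"
proof -
  obtain r where r: "r < \<infinity>" "propagation_at_most t r"
    using t(1) unfolding finite_propagation_def by blast
  have *: "compact_operator ((t o\<^sub>L s) o\<^sub>L P A) \<and> compact_operator (P A o\<^sub>L (t o\<^sub>L s)) \<and>
      compact_operator ((s o\<^sub>L t) o\<^sub>L P A) \<and> compact_operator (P A o\<^sub>L (s o\<^sub>L t))"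
    if A: "A \<in> \<AA>" "diam A < \<infinity>" for A
  proof -
    let ?C = "nbhd A r"
    have "diam ?C < \<infinity>" using nbhd_bounded[OF measurable_subset] A r by blast
    then have c: "compact_operator (s o\<^sub>L P A)" "compact_operator (P A o\<^sub>L s)"
        "compact_operator (s o\<^sub>L P ?C)" "compact_operator (P ?C o\<^sub>L s)"
      using s A nbhd_measurable unfolding locally_compact_operator_def by blast+
    have "P A o\<^sub>L t \<in> bounded_operators" "t o\<^sub>L P A \<in> bounded_operators"
      using bounded_operators_compose t(2) P_bounded[OF A(1)] by blast+
    moreover have "P A o\<^sub>L (t o\<^sub>L s) = (P A o\<^sub>L t) o\<^sub>L (P ?C o\<^sub>L s)"
      using propagation_nbhd(2)[OF r(2) A(1)] by (metis blinfun_compose_assoc)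
    moreover have "(s o\<^sub>L t) o\<^sub>L P A = (s o\<^sub>L P ?C) o\<^sub>L (t o\<^sub>L P A)"
      using propagation_nbhd(1)[OF r(2) A(1)] by (metis blinfun_compose_assoc)
    ultimately have "compact_operator (P A o\<^sub>L (t o\<^sub>L s))" "compact_operator ((s o\<^sub>L t) o\<^sub>L P A)"
      using compact_operator_compose_left[OF _ c(4)] compact_operator_compose_right[OF c(3)]
      by presburger+
    then show ?thesis
      using compact_operator_compose_left[OF t(2) c(1)] compact_operator_compose_right[OF c(2) t(2)]
      by (simp add: blinfun_compose_assoc)
  qed
  then show "locally_compact_operator (t o\<^sub>L s)" "locally_compact_operator (s o\<^sub>L t)"
    unfolding locally_compact_operator_def by blast+
qed

lemma C_Roe_ideal:
  assumes "t \<in> C_cp" and "s \<in> C_Roe"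
  shows "t o\<^sub>L s \<in> C_Roe" and "s o\<^sub>L t \<in> C_Roe"
  using assms locally_compact_compose finite_propagation_compose bounded_operators_compose
  unfolding C_cp_def C_Roe_def
  by (auto elim!: closure_blinfun_compose)

lemma C_cp_subset_multiplier: "C_cp \<subseteq> multiplier_algebra C_Roe"
  unfolding multiplier_algebra_def using C_Roe_ideal C_cp_subset_bounded by blast

subsection \<open>Block-diagonal projections\<close>

text \<open>Compactness encodes finite rank: a projection is compact exactly when its range is
  finite-dimensional. The two product equations say that \<open>q\<close> lies below
  \<open>P A\<close>.\<close>

definition block_projection :: "'x set \<Rightarrow> ('h \<Rightarrow>\<^sub>L 'h) \<Rightarrow> bool" where
  "block_projection A q \<longleftrightarrow> orthogonal_projection q \<and> compact_operator q \<and>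
     P A o\<^sub>L q = q \<and> q o\<^sub>L P A = q"

lemma block_projection_zero: "block_projection A 0"
  by (simp add: block_projection_def orthogonal_projection_zero compact_operator_zero
      blinfun_compose_bilinear_simps)

lemma block_projection_compose_P:
  assumes "block_projection A q" and "A \<in> \<Q>" and "B \<in> \<Q>"
  shows "P B o\<^sub>L q = (if A = B then q else 0)" and "q o\<^sub>L P B = (if A = B then q else 0)"
proof -
  have "P B o\<^sub>L q = (P B o\<^sub>L P A) o\<^sub>L q" "q o\<^sub>L P B = q o\<^sub>L (P A o\<^sub>L P B)"
    using assms(1) unfolding block_projection_def by (metis blinfun_compose_assoc)+
  then show "P B o\<^sub>L q = (if A = B then q else 0)" "q o\<^sub>L P B = (if A = B then q else 0)"
    using piece_P_disjoint[OF assms(2,3)] piece_P_disjoint[OF assms(3,2)] assms(1)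
    by (auto simp: block_projection_def blinfun_compose_bilinear_simps)
qed

text \<open>Finite rank projections can imitate \<open>P A\<close> on any prescribed finite set of
  vectors, so replacing \<open>P A\<close> by one of them loses nothing on the vectors under
  consideration.\<close>

lemma block_projection_exists:
  assumes "A \<in> \<AA>" and "finite S"
  obtains q where "block_projection A q" and "\<And>v. v \<in> S \<Longrightarrow> blinfun_apply q v = blinfun_apply (P A) v"
proof -
  obtain q where q: "orthogonal_projection q" "compact_operator q" "P A o\<^sub>L q = q" "q o\<^sub>L P A = q"
      "\<And>v. v \<in> blinfun_apply (P A) ` S \<Longrightarrow> blinfun_apply q v = v"
    by (rule compact_projection_onto_finite[OF projection[OF assms(1)], of "blinfun_apply (P A) ` S"])
      (use assms(2) in auto)
  have "blinfun_apply q v = blinfun_apply (P A) v" if "v \<in> S" for v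
    using q(4,5) that by (metis blinfun_apply_blinfun_compose imageI)
  then show thesis using that q unfolding block_projection_def by blast
qed

lemma block_projection_sum:
  assumes "finite G" and "G \<subseteq> \<Q>" and R: "\<And>A. A \<in> G \<Longrightarrow> block_projection A (R A)"
  shows "orthogonal_projection (\<Sum>A\<in>G. R A)"
proof (rule orthogonal_projection_sum[OF assms(1)])
  fix A B assume AB: "A \<in> G" "B \<in> G" "A \<noteq> B"
  have "R A o\<^sub>L R B = (R A o\<^sub>L P B) o\<^sub>L R B"
    using R[OF AB(2)] by (simp add: block_projection_def blinfun_compose_assoc)
  also have "R A o\<^sub>L P B = 0"
    using block_projection_compose_P(2)[OF R[OF AB(1)], of B] AB assms(2) by auto
  finally show "R A o\<^sub>L R B = 0" by (simp add: blinfun_compose_bilinear_simps)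
qed (use R in \<open>auto simp: block_projection_def\<close>)

text \<open>A bounded set meets finitely many pieces, so each corner of \<open>q\<close> is cut out
  of a finite sum of compact blocks, whatever their ranks. Sets farther apart than \<rho> never meet
  a common piece, so no block connects them.\<close>

lemma block_diagonal_C_Roe:
  assumes q: "q \<in> bounded_operators"
    and R: "\<And>A. A \<in> \<Q> \<Longrightarrow> block_projection A (R A)"
    and Pq: "\<And>A. A \<in> \<Q> \<Longrightarrow> P A o\<^sub>L q = R A" and qP: "\<And>A. A \<in> \<Q> \<Longrightarrow> q o\<^sub>L P A = R A"
  shows "q \<in> C_Roe"
proof -
  have "locally_compact_operator q"
    unfolding locally_compact_operator_def
  proof (intro ballI impI)
    fix C assume C: "C \<in> \<AA>" "diam C < \<infinity>"
    define G where "G = {A \<in> \<Q>. A \<inter> C \<noteq> {}}"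
    have G: "finite G" "G \<subseteq> \<Q>"
      using locally_finite[OF measurable_subset] C by (auto simp: G_def)
    have "C \<subseteq> \<Union>G"
      using measurable_subset[OF C(1)] partition_onD1[OF partition] by (auto simp: G_def)
    then have "P C = P (\<Union>G) o\<^sub>L P C" "P C = P C o\<^sub>L P (\<Union>G)"
      using P_absorb[OF C(1) Union_measurable[OF G(2)]] by simp_all
    then have "q o\<^sub>L P C = (q o\<^sub>L P (\<Union>G)) o\<^sub>L P C" "P C o\<^sub>L q = P C o\<^sub>L (P (\<Union>G) o\<^sub>L q)"
      by (metis blinfun_compose_assoc)+
    moreover have "q o\<^sub>L P (\<Union>G) = (\<Sum>A\<in>G. R A)" "P (\<Union>G) o\<^sub>L q = (\<Sum>A\<in>G. R A)"
      unfolding P_Union[OF G] sum_blinfun_compose_left sum_blinfun_compose_right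
      using G(2) Pq qP by (auto intro!: sum.cong)
    moreover have "compact_operator (\<Sum>A\<in>G. R A)"
      using R G(2) by (intro compact_operator_sum) (auto simp: block_projection_def)
    ultimately show "compact_operator (q o\<^sub>L P C) \<and> compact_operator (P C o\<^sub>L q)"
      using compact_operator_compose_left compact_operator_compose_right P_bounded[OF C(1)] by metis
  qed
  moreover have "propagation_at_most q \<rho>"
    unfolding propagation_at_most_def
  proof (intro ballI impI)
    fix C C' assume C: "C \<in> \<AA>" "C' \<in> \<AA>" "\<forall>c\<in>C. \<forall>c'\<in>C'. \<rho> < d c' c"
    have block: "P C' o\<^sub>L R A o\<^sub>L P C = 0" if A: "A \<in> \<Q>" for A
    proof -
      have "C' \<inter> A = {} \<or> C \<inter> A = {}"
        using C(3) dist_le_diam[of _ A] mesh[OF A] by (meson Int_emptyI not_le order_trans)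
      then have "P C' o\<^sub>L P A = 0 \<or> P A o\<^sub>L P C = 0"
        using P_disjoint C piece_measurable[OF A] by (metis Int_commute)
      moreover have "P C' o\<^sub>L R A o\<^sub>L P C = (P C' o\<^sub>L P A) o\<^sub>L R A o\<^sub>L (P A o\<^sub>L P C)"
        using R[OF A] unfolding block_projection_def by (metis blinfun_compose_assoc)
      ultimately show ?thesis by (auto simp: blinfun_compose_bilinear_simps)
    qed
    \<comment> \<open>The pieces sum strongly to the identity, so inserting them between
      \<open>q\<close> and \<open>P C\<close> reduces the claim to single blocks.\<close>
    have "P C' (q (P C x)) = 0" for x
    proof -
      have "bounded_linear (\<lambda>y. P C' (q y))"
        using blinfun.bounded_linear_right[of "P C' o\<^sub>L q"] by simp
      then have "((\<lambda>A. P C' (q (P A (P C x)))) has_sum P C' (q (P C x))) \<Q>"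
        by (rule has_sum_bounded_linear[OF _ P_has_sum])
      moreover have "P C' (q (P A (P C x))) = 0" if "A \<in> \<Q>" for A
        using block[OF that] qP[OF that] by (metis blinfun_apply_blinfun_compose zero_blinfun.rep_eq)
      ultimately show ?thesis using has_sum_0 has_sum_unique by (metis (lifting))
    qed
    then show "P C' o\<^sub>L q o\<^sub>L P C = 0" by (intro blinfun_eqI) simp
  qed
  then have "finite_propagation q"
    unfolding finite_propagation_def using mesh_finite by blast
  ultimately show ?thesis
    unfolding C_Roe_def using q by (intro subsetD[OF closure_subset]) simp
qed

text \<open>The infinite orthogonal sum is a weak limit of its finite partial sums, which are
  projections and hence bounded by 1. The coefficients in a fixed row or column of blocks are
  eventually constant, which identifies the blocks of the limit.\<close>

lemma block_diagonal_exists: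
  assumes R: "\<And>A. A \<in> \<Q> \<Longrightarrow> block_projection A (R A)"
  obtains q where "q \<in> C_Roe"
    and "\<And>A. A \<in> \<Q> \<Longrightarrow> P A o\<^sub>L q = R A" and "\<And>A. A \<in> \<Q> \<Longrightarrow> q o\<^sub>L P A = R A"
proof -
  let ?F = "finite_subsets_at_top \<Q>"
  \<comment> \<open>The default 0 makes the norm bound hold at every index, not only at finite sets
    of pieces.\<close>
  define a where "a G = (if finite G \<and> G \<subseteq> \<Q> then (\<Sum>A\<in>G. R A) else 0)" for G
  have a: "orthogonal_projection (a G)" for G
    using block_projection_sum[of G R] R by (auto simp: a_def orthogonal_projection_zero)
  obtain F q where "F \<noteq> bot" "F \<le> ?F"
      and lim: "\<And>x y. ((\<lambda>G. inner x (a G y)) \<longlongrightarrow> inner x (blinfun_apply q y)) F" and "norm q \<le> 1"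
    by (rule weak_operator_compactness[of ?F a 1, OF finite_subsets_at_top_neq_bot
          norm_orthogonal_projection_le[OF a]]) (rule that)
  have ev: "eventually (\<lambda>G. finite G \<and> G \<subseteq> \<Q> \<and> B \<in> G) F" if "B \<in> \<Q>" for B
    using that
    by (intro filter_leD[OF \<open>F \<le> ?F\<close>]) (auto simp: eventually_finite_subsets_at_top intro!: exI[of _ "{B}"])
  have Pa: "P B o\<^sub>L a G = R B" "a G o\<^sub>L P B = R B" if "finite G" "G \<subseteq> \<Q>" "B \<in> G" for B G
  proof -
    have B: "B \<in> \<Q>" using that by blast
    have aG: "a G = (\<Sum>A\<in>G. R A)" using that by (simp add: a_def)
    have "P B o\<^sub>L a G = (\<Sum>A\<in>G. if A = B then R A else 0)"
        "a G o\<^sub>L P B = (\<Sum>A\<in>G. if A = B then R A else 0)"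
      unfolding aG sum_blinfun_compose_left sum_blinfun_compose_right
      using block_projection_compose_P[OF R _ B] that(2) by (intro sum.cong; blast)+
    then show "P B o\<^sub>L a G = R B" "a G o\<^sub>L P B = R B" using that by simp_all
  qed
  have 1: "P B o\<^sub>L q = R B" and 2: "q o\<^sub>L P B = R B" if B: "B \<in> \<Q>" for B
  proof -
    have "inner x (P B (q y)) = inner x (R B y)" for x y
    proof -
      have "eventually (\<lambda>G. inner (P B x) (a G y) = inner x (R B y)) F"
        by (rule eventually_mono[OF ev[OF B]])
          (metis Pa(1) blinfun_apply_blinfun_compose orthogonal_projection_inner projection piece_measurable[OF B])
      then have "((\<lambda>G. inner (P B x) (a G y)) \<longlongrightarrow> inner x (R B y)) F"
        by (rule tendsto_eventually)
      then have "inner (P B x) (q y) = inner x (R B y)"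
        using tendsto_unique[OF \<open>F \<noteq> bot\<close> lim] by blast
      then show ?thesis
        using orthogonal_projection_inner[OF projection[OF piece_measurable[OF B]]] by simp
    qed
    then show "P B o\<^sub>L q = R B" by (intro blinfun_eq_innerI) simp
    have "inner x (q (P B y)) = inner x (R B y)" for x y
    proof -
      have "eventually (\<lambda>G. inner x (a G (P B y)) = inner x (R B y)) F"
        by (rule eventually_mono[OF ev[OF B]]) (metis Pa(2) blinfun_apply_blinfun_compose)
      then have "((\<lambda>G. inner x (a G (P B y))) \<longlongrightarrow> inner x (R B y)) F"
        by (rule tendsto_eventually)
      then show ?thesis using tendsto_unique[OF \<open>F \<noteq> bot\<close> lim] by blast
    qed
    then show "q o\<^sub>L P B = R B" by (intro blinfun_eq_innerI) simp
  qed
  have "q \<in> bounded_operators"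
    using bounded_operators_weak_limit[OF \<open>F \<noteq> bot\<close> _ lim] a
      orthogonal_projection_bounded_operator by blast
  then have "q \<in> C_Roe" using block_diagonal_C_Roe R 1 2 by blast
  then show thesis using that 1 2 by blast
qed

subsection \<open>Multipliers\<close>

lemma Union_disjoint:
  assumes "G \<subseteq> \<Q>" "H \<subseteq> \<Q>" "G \<inter> H = {}"
  shows "\<Union>G \<inter> \<Union>H = {}"
proof (rule equals0I)
  fix x assume "x \<in> \<Union>G \<inter> \<Union>H"
  then obtain A B where AB: "A \<in> G" "B \<in> H" "x \<in> A" "x \<in> B" by blast
  then have "A = B" using piece_disjoint[of A B] assms by blast
  then show False using AB assms(3) by blast
qed

lemma P_Union_absorb: "G \<subseteq> \<Q> \<Longrightarrow> A \<in> \<Q> \<Longrightarrow> P (\<Union>G) o\<^sub>L P A = (if A \<in> G then P A else 0)"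
proof (cases "A \<in> G")
  case True
  then show "G \<subseteq> \<Q> \<Longrightarrow> A \<in> \<Q> \<Longrightarrow> ?thesis"
    using P_absorb[OF piece_measurable Union_measurable, of A G] by auto
next
  case False
  then show ?thesis if "G \<subseteq> \<Q>" "A \<in> \<Q>"
    using P_disjoint[OF Union_measurable piece_measurable, of G A] piece_disjoint that by fastforce
qed

text \<open>If a bad event \<Phi> can always be realised on finitely many pieces outside a
  prescribed finite set, then the events for all \<open>n\<close> are realised on disjoint sets of
  pieces by one element of \<open>C_Roe\<close>. Leaving \<Phi> abstract lets the same construction
  serve for columns and for the whole operator.\<close>

lemma gliding_hump:
  assumes hump: "\<And>n::nat. \<And>J. finite J \<Longrightarrow> J \<subseteq> \<Q> \<Longrightarrow>
      \<exists>G R. finite G \<and> G \<subseteq> \<Q> - J \<and> (\<forall>A\<in>G. block_projection A (R A)) \<and> \<Phi> n G (\<Sum>A\<in>G. R A)"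
  obtains q G where "q \<in> C_Roe" and "\<And>n. finite (G n)" and "\<And>n. G n \<subseteq> \<Q>"
    and "\<And>m n. m \<noteq> n \<Longrightarrow> G m \<inter> G n = {}"
    and "\<And>n. \<Phi> n (G n) (q o\<^sub>L P (\<Union>(G n)))"
    and "\<And>n. P (\<Union>(G n)) o\<^sub>L q = q o\<^sub>L P (\<Union>(G n))"
proof -
  have "\<forall>n J. \<exists>G R. finite J \<and> J \<subseteq> \<Q> \<longrightarrow>
      finite G \<and> G \<subseteq> \<Q> - J \<and> (\<forall>A\<in>G. block_projection A (R A)) \<and> \<Phi> n G (\<Sum>A\<in>G. R A)"
    using hump by meson
  then obtain G' R' where GR': "\<And>n J. finite J \<Longrightarrow> J \<subseteq> \<Q> \<Longrightarrow>
      finite (G' n J) \<and> G' n J \<subseteq> \<Q> - J \<and> (\<forall>A\<in>G' n J. block_projection A (R' n J A)) \<and>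
      \<Phi> n (G' n J) (\<Sum>A\<in>G' n J. R' n J A)"
    by metis
  \<comment> \<open>\<open>J n\<close> collects the pieces consumed by the humps before the
    \<open>n\<close>-th.\<close>
  define J where "J = rec_nat {} (\<lambda>n J. J \<union> G' n J)"
  define G where "G n = G' n (J n)" for n
  define R where "R n = R' n (J n)" for n
  have J_Suc: "J (Suc n) = J n \<union> G n" for n by (simp add: J_def G_def)
  have J: "finite (J n) \<and> J n \<subseteq> \<Q>" for n
  proof (induction n)
    case (Suc n)
    then show ?case using GR'[of "J n" n] unfolding J_Suc G_def by blast
  qed (simp add: J_def)
  have G: "finite (G n)" "G n \<subseteq> \<Q>" "G n \<inter> J n = {}"
      and R: "\<And>A. A \<in> G n \<Longrightarrow> block_projection A (R n A)"
      and \<Phi>: "\<Phi> n (G n) (\<Sum>A\<in>G n. R n A)" for n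
    using GR'[of "J n" n] J[of n] unfolding G_def R_def by blast+
  have less: "G m \<inter> G n = {}" if "m < n" for m n
  proof -
    have "J (Suc m) \<subseteq> J n"
    proof (rule lift_Suc_mono_le[of J])
      show "J k \<subseteq> J (Suc k)" for k by (simp add: J_Suc)
    qed (use that in simp)
    then show ?thesis using G(3)[of n] unfolding J_Suc by blast
  qed
  then have disj: "G m \<inter> G n = {}" if "m \<noteq> n" for m n
    using that by (metis Int_commute linorder_neqE_nat)
  \<comment> \<open>Disjointness makes the hump of a piece unique; pieces in no hump get the zero
    block.\<close>
  define S where "S A = (if \<exists>n. A \<in> G n then R (THE n. A \<in> G n) A else 0)" for A
  have S: "S A = R n A" if "A \<in> G n" for A n
  proof -
    have "(THE n. A \<in> G n) = n" using that disj by blast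
    then show ?thesis using that by (auto simp: S_def)
  qed
  have "block_projection A (S A)" for A
  proof (cases "\<exists>n. A \<in> G n")
    case True
    then show ?thesis using R S by metis
  qed (simp add: S_def block_projection_zero)
  then obtain q where q: "q \<in> C_Roe" "\<And>A. A \<in> \<Q> \<Longrightarrow> P A o\<^sub>L q = S A"
      "\<And>A. A \<in> \<Q> \<Longrightarrow> q o\<^sub>L P A = S A"
    by (rule block_diagonal_exists[of S]) blast
  have qG: "q o\<^sub>L P (\<Union>(G n)) = (\<Sum>A\<in>G n. R n A)" "P (\<Union>(G n)) o\<^sub>L q = (\<Sum>A\<in>G n. R n A)" for n
    unfolding P_Union[OF G(1,2)] sum_blinfun_compose_left sum_blinfun_compose_right
    using q(2,3) S G(2) by (intro sum.cong; force)+
  show thesis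
    by (rule that[OF q(1) G(1,2) disj]) (auto simp: qG intro: \<Phi>)
qed

section \<open>Tails with respect to the partition\<close>

lemma finite_Union_tail:
  assumes "e > 0"
  obtains J where "finite J" and "J \<subseteq> \<Q>"
    and "\<And>G. finite G \<Longrightarrow> G \<subseteq> \<Q> \<Longrightarrow> J \<subseteq> G \<Longrightarrow> norm (blinfun_apply (P (\<Union>G)) x - x) < e"
proof -
  have "eventually (\<lambda>G. dist (\<Sum>A\<in>G. blinfun_apply (P A) x) x < e) (finite_subsets_at_top \<Q>)"
    using tendstoD[OF P_has_sum[unfolded has_sum_def] assms] .
  then obtain J where J: "finite J" "J \<subseteq> \<Q>"
      "\<forall>G. finite G \<and> J \<subseteq> G \<and> G \<subseteq> \<Q> \<longrightarrow> dist (\<Sum>A\<in>G. blinfun_apply (P A) x) x < e"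
    unfolding eventually_finite_subsets_at_top by (elim exE conjE) (rule that)
  show thesis
    by (rule that[OF J(1,2)]) (use J(3) P_Union in \<open>simp add: dist_norm blinfun.sum_left\<close>)
qed

text \<open>Strong convergence of the partial sums is uniform on relatively compact sets: each point
  of a finite net is nearly supported on finitely many pieces, and \<open>J\<close> is the union of
  these sets of pieces.\<close>

lemma compact_operator_tail:
  assumes K: "compact_operator K" and "e > 0"
  obtains J where "finite J" and "J \<subseteq> \<Q>"
    and "\<And>G v. finite G \<Longrightarrow> G \<subseteq> \<Q> \<Longrightarrow> G \<inter> J = {} \<Longrightarrow> norm v \<le> 1 \<Longrightarrow>
      norm (blinfun_apply (P (\<Union>G)) (blinfun_apply K v)) < e"
proof -
  obtain k where k: "finite k" "blinfun_apply K ` cball 0 1 \<subseteq> (\<Union>x\<in>k. ball x (e/2))"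
    using K \<open>e > 0\<close> unfolding compact_operator_iff by (metis half_gt_zero)
  have "\<exists>J. finite J \<and> J \<subseteq> \<Q> \<and> norm (blinfun_apply (P (\<Union>J)) x - x) < e/2" for x
    using finite_Union_tail[of "e/2" x] \<open>e > 0\<close> by (metis half_gt_zero subset_refl)
  then obtain J where J: "\<And>x. finite (J x) \<and> J x \<subseteq> \<Q> \<and> norm (blinfun_apply (P (\<Union>(J x))) x - x) < e/2"
    by metis
  show thesis
  proof (rule that)
    show "finite (\<Union>x\<in>k. J x)" "(\<Union>x\<in>k. J x) \<subseteq> \<Q>" using k(1) J by blast+
    fix G v assume G: "finite G" "G \<subseteq> \<Q>" "G \<inter> (\<Union>x\<in>k. J x) = {}" and "norm (v :: 'h) \<le> 1"
    then have "K v \<in> (\<Union>x\<in>k. ball x (e/2))" by (intro subsetD[OF k(2)]) simp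
    then obtain x where x: "x \<in> k" "norm (K v - x) < e/2"
      by (auto simp: dist_norm norm_minus_commute)
    let ?P = "P (\<Union>G)" and ?Q = "P (\<Union>(J x))"
    have meas: "\<Union>G \<in> \<AA>" "\<Union>(J x) \<in> \<AA>" using G(2) J Union_measurable by blast+
    have "G \<inter> J x = {}" using G(3) x(1) by blast
    then have "\<Union>G \<inter> \<Union>(J x) = {}" using Union_disjoint[OF G(2)] J by blast
    then have "?P o\<^sub>L ?Q = 0" by (rule P_disjoint[OF meas])
    then have "?P (?Q x) = 0" by (metis blinfun_apply_blinfun_compose zero_blinfun.rep_eq)
    \<comment> \<open>Subtracting \<open>?P (?Q x) = 0\<close> leaves two errors, the distance of
      \<open>K v\<close> to the net and the tail of the net point.\<close>
    then have "?P (K v) = ?P ((K v - x) - (?Q x - x))" by (simp add: blinfun.diff_right)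
    also have "norm \<dots> \<le> norm ?P * norm ((K v - x) - (?Q x - x))" by (rule norm_blinfun)
    also have "\<dots> \<le> 1 * norm ((K v - x) - (?Q x - x))"
      using norm_orthogonal_projection_le[OF projection[OF meas(1)]]
      by (intro mult_right_mono) auto
    also have "\<dots> \<le> norm (K v - x) + norm (?Q x - x)" unfolding mult_1 by (rule norm_triangle_ineq4)
    also have "\<dots> < e" using x(2) J[of x] by linarith
    finally show "norm (?P (K v)) < e" .
  qed
qed

text \<open>Finite rank operators in the Roe algebra detect entries between pieces at infinite distance;
  the remaining entries have finite propagation since the pieces are bounded.\<close>

lemma multiplier_entry_C_cp:
  assumes t: "t \<in> multiplier_algebra C_Roe" and A: "A \<in> \<Q>" and B: "B \<in> \<Q>"
  shows "P A o\<^sub>L t o\<^sub>L P B \<in> C_cp"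
proof (cases "\<exists>a\<in>A. \<exists>b\<in>B. d a b < \<infinity>")
  case True
  then obtain a b where ab: "a \<in> A" "b \<in> B" "d a b < \<infinity>" by blast
  let ?r = "\<rho> + d a b + \<rho>"
  have le: "d x y \<le> ?r" if "x \<in> A" "y \<in> B" for x y
  proof -
    have "d x y \<le> d x a + d a b + d b y"
      using that ab A B measurable_subset piece_measurable by (intro dist_triangle4) blast+
    also have "\<dots> \<le> ?r"
      using dist_le_diam[of x A a] dist_le_diam[of b B y] that ab mesh[OF A] mesh[OF B]
      by (intro add_mono) (auto intro: order_trans)
    finally show ?thesis .
  qed
  have "propagation_at_most (P A o\<^sub>L t o\<^sub>L P B) ?r"
    unfolding propagation_at_most_def
  proof (intro ballI impI)
    fix C C' assume C: "C \<in> \<AA>" "C' \<in> \<AA>" "\<forall>c\<in>C. \<forall>c'\<in>C'. ?r < d c' c"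
    have "C' \<inter> A = {} \<or> B \<inter> C = {}"
      using C(3) le by (meson Int_emptyI not_le)
    then have "P C' o\<^sub>L P A = 0 \<or> P B o\<^sub>L P C = 0"
      using P_disjoint C piece_measurable[OF A] piece_measurable[OF B] by blast
    moreover have "P C' o\<^sub>L (P A o\<^sub>L t o\<^sub>L P B) o\<^sub>L P C = (P C' o\<^sub>L P A) o\<^sub>L t o\<^sub>L (P B o\<^sub>L P C)"
      by (simp add: blinfun_compose_assoc)
    ultimately show "P C' o\<^sub>L (P A o\<^sub>L t o\<^sub>L P B) o\<^sub>L P C = 0"
      by (auto simp: blinfun_compose_bilinear_simps)
  qed
  moreover have "?r < \<infinity>" using ab(3) mesh_finite by (simp add: ennreal_add_less_top)
  moreover have "P A o\<^sub>L t o\<^sub>L P B \<in> bounded_operators"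
    using t A B by (intro bounded_operators_compose P_bounded piece_measurable)
      (auto simp: multiplier_algebra_def)
  ultimately show ?thesis by (intro C_cp_I)
next
  case False
  then have far: "\<forall>b\<in>B. \<forall>a\<in>A. r < d a b" if "r < \<infinity>" for r
    using that by (metis infinity_ennreal_def top.not_eq_extremum)
  have AB: "A \<in> \<AA>" "B \<in> \<AA>" using A B piece_measurable by auto
  \<comment> \<open>Operators of finite propagation have no entry between pieces at infinite
    distance, and a vanishing entry is a norm closed condition.\<close>
  have zero: "P A o\<^sub>L a o\<^sub>L P B = 0" if a: "a \<in> C_cp" for a
  proof -
    have "continuous_on UNIV (\<lambda>a. P A o\<^sub>L a o\<^sub>L P B)" by (intro continuous_intros)
    then have "closed {a. P A o\<^sub>L a o\<^sub>L P B = 0}"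
      by (intro closed_Collect_eq continuous_on_const)
    then have "C_cp \<subseteq> {a. P A o\<^sub>L a o\<^sub>L P B = 0}"
      unfolding C_cp_def using far AB
      by (intro closure_minimal) (auto simp: finite_propagation_def propagation_at_most_def)
    then show ?thesis using a by blast
  qed
  have "P A (t (P B v)) = 0" for v
  proof -
    obtain s where s: "block_projection B s" "s v = P B v"
      using block_projection_exists[OF AB(2), of "{v}"] by blast
    \<comment> \<open>The block-diagonal extension of \<open>s\<close> fixes \<open>P B v\<close>,
      so this vector cannot distinguish \<open>t\<close> from \<open>t o\<^sub>L q\<close>.\<close>
    define R where "R C = (if C = B then s else 0)" for C
    have "block_projection C (R C)" for C
      using s(1) block_projection_zero by (simp add: R_def)
    then obtain q where q: "q \<in> C_Roe" "q o\<^sub>L P B = R B"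
      using block_diagonal_exists[of R] B by metis
    have "t o\<^sub>L q \<in> C_cp"
      using t q(1) C_Roe_subset_C_cp by (auto simp: multiplier_algebra_def)
    then have "P A (t (q (P B v))) = 0"
      using zero by (metis blinfun_apply_blinfun_compose zero_blinfun.rep_eq)
    moreover have "q (P B v) = P B v"
      using q(2) s(2) unfolding R_def by (metis blinfun_apply_blinfun_compose)
    ultimately show ?thesis by simp
  qed
  then have "P A o\<^sub>L t o\<^sub>L P B = 0" by (intro blinfun_eqI) simp
  then show ?thesis using C_cp_I[OF bounded_operators_zero propagation_zero, of 0] by simp
qed

text \<open>If the tails of a column did not vanish, infinitely many disjoint humps of it would survive
  in \<open>q t 1\<^sub>B\<close> for a single block-diagonal \<open>q\<close> in the Roe algebra, contradicting compactness.\<close>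

lemma multiplier_column_C_cp:
  assumes t: "t \<in> multiplier_algebra C_Roe" and B: "B \<in> \<Q>"
  shows "t o\<^sub>L P B \<in> C_cp"
proof (rule C_cp_memI)
  fix e :: real assume "e > 0"
  let ?T = "t o\<^sub>L P B"
  have "\<exists>J. finite J \<and> J \<subseteq> \<Q> \<and> norm (?T - (P (\<Union>J) o\<^sub>L ?T)) \<le> e"
  proof (rule ccontr)
    assume contra: "\<not> ?thesis"
    \<comment> \<open>The threshold is the same for all \<open>n\<close>: the humps need only be
      infinitely many and uniformly large.\<close>
    define \<Phi> where "\<Phi> n G s \<longleftrightarrow> (\<exists>v. norm v \<le> 1 \<and> e < norm (blinfun_apply s (?T v)))"
      for n :: nat and G :: "'x set set" and s :: "'h \<Rightarrow>\<^sub>L 'h"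
    have "\<exists>G R. finite G \<and> G \<subseteq> \<Q> - J \<and> (\<forall>A\<in>G. block_projection A (R A)) \<and> \<Phi> n G (\<Sum>A\<in>G. R A)"
      if J: "finite J" "J \<subseteq> \<Q>" for n J
    proof -
      let ?D = "?T - (P (\<Union>J) o\<^sub>L ?T)"
      have "\<exists>v. e * norm v < norm (?D v)"
        using contra J norm_blinfun_bound[of e ?D] \<open>e > 0\<close> by (meson less_imp_le not_le)
      then obtain v where v: "e * norm v < norm (?D v)" by blast
      then have "v \<noteq> 0" by auto
      define u where "u = (1 / norm v) *\<^sub>R v"
      have u: "norm u \<le> 1" "e < norm (?D u)"
        using v \<open>v \<noteq> 0\<close> by (simp_all add: u_def blinfun.scaleR_right field_simps)
      \<comment> \<open>The tolerance is the excess of \<open>norm (?D u)\<close> over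
        \<open>e\<close>, so that the part on \<open>G\<close> still exceeds
        \<open>e\<close>.\<close>
      obtain J' where J': "finite J'" "J' \<subseteq> \<Q>"
          "\<And>G. finite G \<Longrightarrow> G \<subseteq> \<Q> \<Longrightarrow> J' \<subseteq> G \<Longrightarrow> norm (P (\<Union>G) (?T u) - ?T u) < norm (?D u) - e"
        using finite_Union_tail[of "norm (?D u) - e" "?T u"] u(2) by auto
      define G where "G = J' - J"
      have G: "finite G" "G \<subseteq> \<Q>" using J' by (auto simp: G_def)
      have "P (\<Union>(J \<union> J')) = P (\<Union>J) + P (\<Union>G)"
        using P_Union[of "J \<union> J'"] P_Union[OF J] P_Union[OF G] J J'
          sum.union_disjoint[of J G P] by (simp add: G_def)
      moreover have "norm (P (\<Union>(J \<union> J')) (?T u) - ?T u) < norm (?D u) - e"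
        using J J' by (intro J'(3)) auto
      ultimately have "norm (P (\<Union>G) (?T u) - ?D u) < norm (?D u) - e"
        by (simp add: blinfun.add_left blinfun.diff_left algebra_simps)
      moreover have "norm (?D u) \<le> norm (P (\<Union>G) (?T u)) + norm (P (\<Union>G) (?T u) - ?D u)"
        by (metis norm_minus_commute norm_triangle_sub)
      ultimately have large: "e < norm (P (\<Union>G) (?T u))" by linarith
      \<comment> \<open>Only the single vector \<open>?T u\<close> has to be seen by the hump, which
        is why finite rank suffices.\<close>
      have "\<forall>A. \<exists>q. A \<in> \<AA> \<longrightarrow> block_projection A q \<and> q (?T u) = P A (?T u)"
        using block_projection_exists[of _ "{?T u}"] by (metis finite.emptyI finite_insert insertI1)
      then obtain R where R: "\<And>A. A \<in> \<AA> \<Longrightarrow> block_projection A (R A) \<and> R A (?T u) = P A (?T u)"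
        by metis
      have "(\<Sum>A\<in>G. R A) (?T u) = P (\<Union>G) (?T u)"
        unfolding P_Union[OF G] blinfun.sum_left using R G(2) piece_measurable
        by (intro sum.cong) blast+
      then have "\<Phi> n G (\<Sum>A\<in>G. R A)" using large u(1) unfolding \<Phi>_def by metis
      moreover have "\<forall>A\<in>G. block_projection A (R A)" using R G(2) piece_measurable by blast
      moreover have "G \<subseteq> \<Q> - J" using G by (auto simp: G_def)
      ultimately show ?thesis using G(1) by blast
    qed
    then obtain q G where q: "q \<in> C_Roe" and G: "\<And>n. finite (G n)" "\<And>n. G n \<subseteq> \<Q>"
      and disj: "\<And>m n. m \<noteq> n \<Longrightarrow> G m \<inter> G n = {}"
      and \<Phi>: "\<And>n. \<Phi> n (G n) (q o\<^sub>L P (\<Union>(G n)))"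
      and comm: "\<And>n. P (\<Union>(G n)) o\<^sub>L q = q o\<^sub>L P (\<Union>(G n))"
      by (rule gliding_hump[of \<Phi>]) blast+
    define K where "K = (q o\<^sub>L t) o\<^sub>L P B"
    have "q o\<^sub>L t \<in> C_Roe" using t q by (simp add: multiplier_algebra_def)
    moreover have "diam B < \<infinity>" using mesh[OF B] mesh_finite by (rule order_le_less_trans)
    ultimately have "compact_operator K"
      unfolding K_def using B piece_measurable by (intro C_Roe_compact)
    then obtain J where J: "finite J" "\<And>G v. finite G \<Longrightarrow> G \<subseteq> \<Q> \<Longrightarrow> G \<inter> J = {} \<Longrightarrow> norm v \<le> 1 \<Longrightarrow>
        norm (P (\<Union>G) (K v)) < e"
      using compact_operator_tail[OF _ \<open>e > 0\<close>] by metis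
    \<comment> \<open>The sets \<open>G n\<close> are pairwise disjoint, so a finite
      \<open>J\<close> cannot meet all of them.\<close>
    have "\<exists>n. G n \<inter> J = {}"
    proof (rule ccontr)
      assume "\<not> ?thesis"
      then have "\<forall>n. \<exists>A. A \<in> G n \<inter> J" by blast
      then obtain f where f: "\<And>n. f n \<in> G n \<inter> J" by metis
      have "inj f" by (rule injI) (metis IntD1 IntI disj emptyE f)
      moreover have "range f \<subseteq> J" using f by blast
      ultimately show False using \<open>finite J\<close> finite_subset range_inj_infinite by blast
    qed
    then obtain n where n: "G n \<inter> J = {}" by blast
    obtain v where v: "norm v \<le> 1" "e < norm ((q o\<^sub>L P (\<Union>(G n))) (?T v))"
      using \<Phi>[of n] unfolding \<Phi>_def by blast
    \<comment> \<open>The hump projection moves to the left of \<open>q\<close>, where the tail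
      estimate for \<open>K\<close> applies.\<close>
    have "(q o\<^sub>L P (\<Union>(G n))) (?T v) = P (\<Union>(G n)) (K v)"
      unfolding comm[symmetric] by (simp add: K_def)
    then show False using v J(2)[OF G n v(1)] by simp
  qed
  then obtain J where J: "finite J" "J \<subseteq> \<Q>" "norm (?T - (P (\<Union>J) o\<^sub>L ?T)) \<le> e" by blast
  have "P (\<Union>J) o\<^sub>L ?T = (\<Sum>A\<in>J. P A o\<^sub>L t o\<^sub>L P B)"
    by (simp add: P_Union[OF J(1,2)] sum_blinfun_compose_left blinfun_compose_assoc)
  also have "\<dots> \<in> C_cp" using multiplier_entry_C_cp[OF t _ B] J(2) by (intro C_cp_sum) blast
  finally show "\<exists>a\<in>C_cp. norm (?T - a) \<le> e" using J(3) by blast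
qed

text \<open>A weak limit along growing finite sets of pieces and of vectors. The products
  \<open>t o\<^sub>L q i\<close> converge strongly to \<open>t o\<^sub>L P (X - \<Union>J)\<close>,
  while the approximants have a weak limit point, and both \<open>r\<close> and \<open>e\<close> are
  uniform in the index.\<close>

lemma approximation_from_finite_rank:
  assumes J: "finite J" "J \<subseteq> \<Q>" and "0 \<le> e"
    and approx: "\<And>G R. finite G \<Longrightarrow> G \<subseteq> \<Q> - J \<Longrightarrow> (\<And>A. A \<in> G \<Longrightarrow> block_projection A (R A)) \<Longrightarrow>
      \<exists>a\<in>bounded_operators. propagation_at_most a r \<and> norm ((t o\<^sub>L (\<Sum>A\<in>G. R A)) - a) \<le> e"
  shows "\<exists>a\<in>bounded_operators. propagation_at_most a r \<and> norm ((t o\<^sub>L P (X - \<Union>J)) - a) \<le> e"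
proof -
  let ?p = "P (X - \<Union>J)"
  have "\<forall>A S. \<exists>q. A \<in> \<AA> \<and> finite S \<longrightarrow> block_projection A q \<and> (\<forall>v\<in>S. q v = P A v)"
    using block_projection_exists by metis
  then obtain R where R: "\<And>A S. A \<in> \<AA> \<Longrightarrow> finite S \<Longrightarrow>
      block_projection A (R A S) \<and> (\<forall>v\<in>S. R A S v = P A v)"
    by metis
  define q where "q i = (\<Sum>A\<in>fst i. R A (snd i))" for i
  \<comment> \<open>The first component lists the pieces in use, the second the vectors on which the
    finite rank blocks must agree with \<open>P A\<close>.\<close>
  define valid where "valid i \<longleftrightarrow> finite (fst i) \<and> fst i \<subseteq> \<Q> - J \<and> finite (snd i)"
    for i :: "'x set set \<times> 'h set"
  have "\<exists>a\<in>bounded_operators. propagation_at_most a r \<and> norm ((t o\<^sub>L q i) - a) \<le> e" if i: "valid i" for i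
    unfolding q_def
    by (rule approx) (use i R piece_measurable in \<open>auto simp: valid_def\<close>)
  then obtain a' where a': "\<And>i. valid i \<Longrightarrow> a' i \<in> bounded_operators \<and>
      propagation_at_most (a' i) r \<and> norm ((t o\<^sub>L q i) - a' i) \<le> e"
    by metis
  \<comment> \<open>Zero at invalid indices keeps norm and propagation bounded everywhere;
    eventually all indices are valid.\<close>
  define a where "a i = (if valid i then a' i else 0)" for i
  have a: "a i \<in> bounded_operators" "propagation_at_most (a i) r" for i
    using a' by (auto simp: a_def bounded_operators_zero propagation_zero)
  have "norm (a i) \<le> norm t + e" for i
  proof (cases "valid i")
    case True
    have "orthogonal_projection (q i)"
      unfolding q_def
      by (rule block_projection_sum) (use True R piece_measurable in \<open>auto simp: valid_def\<close>)
    then have "norm (t o\<^sub>L q i) \<le> norm t" by (rule norm_compose_projection_le)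
    moreover have "norm (a i) \<le> norm (t o\<^sub>L q i) + norm ((t o\<^sub>L q i) - a i)"
      by (metis norm_minus_commute norm_triangle_sub)
    ultimately show ?thesis using a'[OF True] True by (simp add: a_def)
  qed (simp add: a_def \<open>0 \<le> e\<close>)
  moreover define F where "F = finite_subsets_at_top (\<Q> - J) \<times>\<^sub>F finite_subsets_at_top (UNIV :: 'h set)"
  have "F \<noteq> bot" by (simp add: F_def prod_filter_eq_bot)
  ultimately obtain F' b where F': "F' \<noteq> bot" "F' \<le> F"
      and lim: "\<And>x y. ((\<lambda>i. inner x (a i y)) \<longlongrightarrow> inner x (blinfun_apply b y)) F'" and "norm b \<le> norm t + e"
    using weak_operator_compactness[of F a "norm t + e"] by metis
  have b: "b \<in> bounded_operators" "propagation_at_most b r"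
    by (rule bounded_operators_weak_limit[OF F'(1) a(1) lim],
        rule propagation_weak_limit[OF F'(1) a(2) lim])
  have ev: "eventually (\<lambda>i. valid i \<and> y \<in> snd i) F" for y
    unfolding F_def eventually_prod_filter valid_def
    by (rule exI[of _ "\<lambda>G. finite G \<and> G \<subseteq> \<Q> - J"], rule exI[of _ "\<lambda>S. finite S \<and> y \<in> S"])
      (auto simp: eventually_finite_subsets_at_top intro: exI[of _ "{y}"])
  \<comment> \<open>Once the second component contains \<open>y\<close>, the vector
    \<open>q i y\<close> is a partial sum of the decomposition of \<open>y\<close> over the pieces
    outside \<open>J\<close>.\<close>
  have q_lim: "((\<lambda>i. q i y) \<longlongrightarrow> ?p y) F" for y
  proof -
    have meas: "\<Union>J \<in> \<AA>" by (rule Union_measurable[OF J(2)])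
    have "((\<lambda>A. ?p (P A y)) has_sum ?p y) \<Q>"
      by (rule has_sum_bounded_linear[OF blinfun.bounded_linear_right P_has_sum])
    moreover have "?p (P A y) = (if A \<in> J then 0 else P A y)" if "A \<in> \<Q>" for A
      using arg_cong[where f = "\<lambda>s. blinfun_apply s y", OF P_Union_absorb[OF J(2) that]]
      by (auto simp: P_Compl[OF meas] blinfun.diff_left split: if_splits)
    ultimately have "((\<lambda>A. P A y) has_sum ?p y) (\<Q> - J)"
      by (subst (asm) has_sum_cong_neutral[where T = "\<Q> - J" and g = "\<lambda>A. P A y"]) (use J in auto)
    then have "((\<lambda>i. \<Sum>A\<in>fst i. P A y) \<longlongrightarrow> ?p y) F"
      unfolding has_sum_def F_def by (rule filterlim_compose[OF _ filterlim_fst])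
    moreover have "eventually (\<lambda>i. (\<Sum>A\<in>fst i. P A y) = q i y) F"
    proof (rule eventually_mono[OF ev[of y]])
      fix i :: "'x set set \<times> 'h set" assume i: "valid i \<and> y \<in> snd i"
      show "(\<Sum>A\<in>fst i. P A y) = q i y"
        unfolding q_def blinfun.sum_left
        by (intro sum.cong refl) (use i R piece_measurable in \<open>auto simp: valid_def\<close>)
    qed
    ultimately show ?thesis by (rule Lim_transform_eventually)
  qed
  have "norm ((t o\<^sub>L ?p) - b) \<le> e"
  proof (rule norm_blinfun_le_inner[OF \<open>0 \<le> e\<close>])
    fix x y
    have "((\<lambda>i. inner x (t (q i y)) - inner x (a i y)) \<longlongrightarrow> inner x (t (?p y)) - inner x (b y)) F'"
      by (intro tendsto_diff lim tendsto_inner[OF tendsto_const]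
          bounded_linear.tendsto[OF blinfun.bounded_linear_right] tendsto_mono[OF F'(2) q_lim])
    moreover have "eventually (\<lambda>i. inner x (t (q i y)) - inner x (a i y) \<le> e * norm x * norm y) F'"
    proof (rule filter_leD[OF F'(2)], rule eventually_mono[OF ev[of y]])
      fix i assume "valid i \<and> y \<in> snd i"
      then have "norm ((t o\<^sub>L q i) - a i) \<le> e" using a' by (simp add: a_def)
      have "inner x (t (q i y)) - inner x (a i y) = inner x (((t o\<^sub>L q i) - a i) y)"
        by (simp add: blinfun.diff_left inner_diff_right)
      also have "\<dots> \<le> norm ((t o\<^sub>L q i) - a i) * norm x * norm y" by (rule inner_blinfun_le)
      also have "\<dots> \<le> e * norm x * norm y"
        using \<open>norm ((t o\<^sub>L q i) - a i) \<le> e\<close> by (intro mult_right_mono) auto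
      finally show "inner x (t (q i y)) - inner x (a i y) \<le> e * norm x * norm y" .
    qed
    ultimately have "inner x (t (?p y)) - inner x (b y) \<le> e * norm x * norm y"
      by (rule tendsto_upperbound[OF _ _ F'(1)])
    then show "inner x (((t o\<^sub>L ?p) - b) y) \<le> e * norm x * norm y"
      by (simp add: blinfun.diff_left inner_diff_right)
  qed
  then show ?thesis using b by blast
qed

lemma multiplier_subset_C_cp: "multiplier_algebra C_Roe \<subseteq> C_cp"
proof
  fix t assume t: "t \<in> multiplier_algebra C_Roe"
  define approx where "approx s e n \<longleftrightarrow>
      (\<exists>a\<in>bounded_operators. propagation_at_most a (of_nat n) \<and> norm (s - a) \<le> e)"
    for s and e :: real and n :: nat
  show "t \<in> C_cp"
  proof (rule ccontr)
    assume "t \<notin> C_cp"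
    then obtain e where "e > 0" and e: "\<And>a. a \<in> C_cp \<Longrightarrow> e < norm (t - a)"
      using C_cp_memI by (metis not_le)
    \<comment> \<open>Half of \<open>e\<close> is spent on the part outside \<open>J\<close>, the
      other half on the finitely many columns over \<open>J\<close>.\<close>
    define \<Phi> where "\<Phi> n G s \<longleftrightarrow> \<not> approx (t o\<^sub>L s) (e / 2) n"
      for n :: nat and G :: "'x set set" and s :: "'h \<Rightarrow>\<^sub>L 'h"
    have "\<exists>G R. finite G \<and> G \<subseteq> \<Q> - J \<and> (\<forall>A\<in>G. block_projection A (R A)) \<and> \<Phi> n G (\<Sum>A\<in>G. R A)"
      if J: "finite J" "J \<subseteq> \<Q>" for n J
    proof (rule ccontr)
      assume "\<not> ?thesis"
      then have "\<And>G R. finite G \<Longrightarrow> G \<subseteq> \<Q> - J \<Longrightarrow> (\<And>A. A \<in> G \<Longrightarrow> block_projection A (R A)) \<Longrightarrow>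
          approx (t o\<^sub>L (\<Sum>A\<in>G. R A)) (e / 2) n"
        unfolding \<Phi>_def by blast
      then obtain a where a: "a \<in> bounded_operators" "propagation_at_most a (of_nat n)"
          "norm ((t o\<^sub>L P (X - \<Union>J)) - a) \<le> e / 2"
        using approximation_from_finite_rank[OF J, of "e / 2" "of_nat n" t] \<open>e > 0\<close>
        unfolding approx_def by auto
      have "t o\<^sub>L P (\<Union>J) \<in> C_cp"
        unfolding P_Union[OF J] sum_blinfun_compose_right
        using multiplier_column_C_cp[OF t] J(2) by (intro C_cp_sum) blast
      \<comment> \<open>The propagation \<open>m\<close> depends on \<open>J\<close> and is
        unrelated to \<open>n\<close>; this is harmless, as only membership of \<open>a + b\<close>
        in \<open>C_cp\<close> is contradicted.\<close>
      then obtain b m where b: "b \<in> bounded_operators" "propagation_at_most b (of_nat m)"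
          "norm ((t o\<^sub>L P (\<Union>J)) - b) < e / 2"
        using C_cp_approx \<open>e > 0\<close> by (metis half_gt_zero)
      have "a + b \<in> C_cp"
        using a b by (intro C_cp_add C_cp_I[of _ "of_nat _"]) (auto simp: of_nat_less_top)
      moreover have split: "t - (a + b) = ((t o\<^sub>L P (X - \<Union>J)) - a) + ((t o\<^sub>L P (\<Union>J)) - b)"
        by (simp add: P_Compl[OF Union_measurable[OF J(2)]] blinfun_compose_bilinear_simps
            blinfun_compose_id)
      have "norm (t - (a + b)) \<le> e / 2 + e / 2"
        unfolding split using a(3) b(3) by (intro norm_triangle_mono) auto
      ultimately show False using e[of "a + b"] by simp
    qed
    then obtain q G where q: "q \<in> C_Roe" and G: "\<And>n. G n \<subseteq> \<Q>"
      and \<Phi>: "\<And>n. \<Phi> n (G n) (q o\<^sub>L P (\<Union>(G n)))"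
      by (rule gliding_hump[of \<Phi>]) blast+
    have "t o\<^sub>L q \<in> C_cp"
      using t q C_Roe_subset_C_cp by (auto simp: multiplier_algebra_def)
    \<comment> \<open>The propagation of this approximant selects the hump on which it must
      fail.\<close>
    then obtain a n where a: "a \<in> bounded_operators" "propagation_at_most a (of_nat n)"
        "norm ((t o\<^sub>L q) - a) < e / 2"
      using C_cp_approx \<open>e > 0\<close> by (metis half_gt_zero)
    let ?p = "P (\<Union>(G n))"
    have meas: "\<Union>(G n) \<in> \<AA>" by (rule Union_measurable[OF G])
    have "norm (((t o\<^sub>L q) - a) o\<^sub>L ?p) \<le> norm ((t o\<^sub>L q) - a)"
      by (rule norm_compose_projection_le[OF projection[OF meas]])
    then have "norm ((t o\<^sub>L (q o\<^sub>L ?p)) - (a o\<^sub>L ?p)) \<le> e / 2"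
      using a(3) by (simp add: blinfun_compose_bilinear_simps blinfun_compose_assoc)
    moreover have "propagation_at_most (a o\<^sub>L ?p) (of_nat n)"
      by (rule propagation_compose_P[OF a(2) meas])
    moreover have "a o\<^sub>L ?p \<in> bounded_operators"
      by (rule bounded_operators_compose[OF a(1) P_bounded[OF meas]])
    ultimately show False using \<Phi>[of n] unfolding \<Phi>_def approx_def by blast
  qed
qed

end

section \<open>Coarsening to a locally finite partition\<close>

context extended_metric_space
begin

lemma openin_eball: "x \<in> X \<Longrightarrow> openin etopology (eball x r)"
  unfolding openin_etopology
proof (intro conjI ballI)
  fix y assume x: "x \<in> X" and "y \<in> eball x r"
  then have y: "y \<in> X" "d x y < r" by (auto simp: eball_def)
  have "eball y (r - d x y) \<subseteq> eball x r"
  proof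
    fix z assume "z \<in> eball y (r - d x y)"
    then have z: "z \<in> X" "d y z < r - d x y" by (auto simp: eball_def)
    have "d x z \<le> d x y + d y z" using x y z by (intro dist_triangle)
    also have "\<dots> < r" using z(2) less_diff_eq_ennreal[of r "d x y" "d y z"] order_less_le_trans[OF y(2) top_greatest]
      by (simp add: add.commute)
    finally show "z \<in> eball x r" using z by (simp add: eball_def)
  qed
  moreover have "0 < r - d x y" using y(2) by (simp add: diff_gr0_ennreal)
  ultimately show "\<exists>s>0. eball y s \<subseteq> eball x r" by blast
qed (auto simp: eball_def)

text \<open>By Zorn's lemma: a point farther than \<open>r\<close> from every point of a maximal
  separated set could be adjoined to it.\<close>

lemma maximal_separated_set:
  obtains N where "N \<subseteq> X" and "\<And>x y. x \<in> N \<Longrightarrow> y \<in> N \<Longrightarrow> x \<noteq> y \<Longrightarrow> r < d x y"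
    and "\<And>x. x \<in> X \<Longrightarrow> \<exists>n\<in>N. d x n \<le> r"
proof -
  let ?S = "{N. N \<subseteq> X \<and> (\<forall>x\<in>N. \<forall>y\<in>N. x \<noteq> y \<longrightarrow> r < d x y)}"
  have "\<exists>M\<in>?S. \<forall>N\<in>?S. M \<subseteq> N \<longrightarrow> N = M"
  proof (rule subset_Zorn')
    fix C assume C: "subset.chain ?S C"
    then have CS: "C \<subseteq> ?S" and lin: "\<And>M N. M \<in> C \<Longrightarrow> N \<in> C \<Longrightarrow> M \<subseteq> N \<or> N \<subseteq> M"
      unfolding subset_chain_def by auto
    have "r < d x y" if xy: "x \<in> \<Union>C" "y \<in> \<Union>C" "x \<noteq> y" for x y
    proof -
      obtain M N where MN: "M \<in> C" "N \<in> C" "x \<in> M" "y \<in> N" using xy by blast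
      then obtain K where "K \<in> C" "x \<in> K" "y \<in> K" using lin[of M N] by blast
      then show ?thesis using CS xy(3) by blast
    qed
    then show "\<Union>C \<in> ?S" using CS by blast
  qed
  then obtain M where M: "M \<in> ?S" and max: "\<forall>N\<in>?S. M \<subseteq> N \<longrightarrow> N = M" by (rule bexE)
  have "\<exists>n\<in>M. d x n \<le> r" if x: "x \<in> X" for x
  proof (rule ccontr)
    assume "\<not> ?thesis"
    then have far: "\<And>n. n \<in> M \<Longrightarrow> r < d x n" by (meson not_le)
    have "M \<subseteq> X" using M by simp
    have "r < d n x" if "n \<in> M" for n
      using far[OF that] dist_commute[OF x, of n] \<open>M \<subseteq> X\<close> that by auto
    then have "insert x M \<in> ?S" using far M x by auto
    then have "insert x M = M" using max by (meson subset_insertI)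
    then have "x \<in> M" by blast
    then have "r < d x x" by (rule far)
    then show False using dist_zero[OF x x] by simp
  qed
  then show thesis using M by (intro that[of M]) auto
qed

text \<open>Finitely many open unit balls cover the compact ball, and each contains at most one
  point of \<open>N\<close>, since two points in it would be at distance at most 2.\<close>

lemma proper_separated_finite:
  assumes proper and N: "N \<subseteq> X" "\<And>x y. x \<in> N \<Longrightarrow> y \<in> N \<Longrightarrow> x \<noteq> y \<Longrightarrow> 2 < d x y"
    and "x \<in> X" and "R < \<infinity>"
  shows "finite (N \<inter> ecball x R)"
proof -
  have "compactin etopology (ecball x R)"
    using assms(1,4,5) by (simp add: proper_def)
  moreover have "ecball x R \<subseteq> \<Union>((\<lambda>y. eball y 1) ` ecball x R)"
    using dist_zero by (force simp: ecball_def eball_def)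
  moreover have "openin etopology U" if "U \<in> (\<lambda>y. eball y 1) ` ecball x R" for U
    using that openin_eball by (auto simp: ecball_def)
  ultimately obtain \<F> where \<F>: "finite \<F>" "\<F> \<subseteq> (\<lambda>y. eball y 1) ` ecball x R" "ecball x R \<subseteq> \<Union>\<F>"
    by (metis (no_types, lifting) compactinD)
  have "\<forall>n\<in>N \<inter> ecball x R. \<exists>U. U \<in> \<F> \<and> n \<in> U" using \<F>(3) by blast
  then obtain f where f: "\<And>n. n \<in> N \<inter> ecball x R \<Longrightarrow> f n \<in> \<F> \<and> n \<in> f n" by metis
  have "inj_on f (N \<inter> ecball x R)"
  proof (rule inj_onI, rule ccontr)
    fix m n assume mn: "m \<in> N \<inter> ecball x R" "n \<in> N \<inter> ecball x R" "f m = f n" "m \<noteq> n"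
    obtain y where y: "y \<in> X" "f m = eball y 1" using f[OF mn(1)] \<F>(2) by (auto simp: ecball_def)
    have my: "m \<in> X" "d y m < 1" and ny: "n \<in> X" "d y n < 1"
      using f[OF mn(1)] f[OF mn(2)] mn(3) y(2) by (auto simp: eball_def)
    have "d m n \<le> d m y + d y n" using my ny y by (intro dist_triangle)
    also have "\<dots> \<le> 1 + 1" using my ny dist_commute[OF my(1) y(1)] by (intro add_mono) auto
    finally show False using N(2)[of m n] mn by (simp add: not_le[symmetric])
  qed
  moreover have "f ` (N \<inter> ecball x R) \<subseteq> \<F>" using f by blast
  ultimately show ?thesis using \<F>(1) finite_subset finite_imageD by metis
qed

end

text \<open>Properness enters only here: the given pieces are merged according to a nearby point of a
  maximal separated set, of which every bounded set contains finitely many points.\<close>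

lemma (in X_module) locally_finite_coarsening:
  assumes proper and discrete
  obtains \<Q> \<rho> where "locally_finite_module X d \<AA> P \<Q> \<rho>"
proof -
  obtain r \<P> where r: "r < \<infinity>" and \<P>: "partition_on X \<P>" "\<P> \<subseteq> \<AA>"
    and mesh': "\<forall>A\<in>\<P>. diam A \<le> r"
    and sum': "\<forall>x. ((\<lambda>A. blinfun_apply (P A) x) has_sum x) \<P>"
    and meas': "\<forall>C. C \<subseteq> X \<longrightarrow> (\<forall>A\<in>\<P>. C \<inter> A \<in> \<AA>) \<longrightarrow> C \<in> \<AA>"
    using assms(2) unfolding discrete_def by (elim exE conjE) (rule that)
  note mesh = mesh'[rule_format] and sum = sum'[rule_format] and meas = meas'[rule_format]
  have \<P>_eq: "A = B" if "A \<in> \<P>" "B \<in> \<P>" "x \<in> A" "x \<in> B" for A B x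
    using partition_onD2[OF \<P>(1)] that by (auto simp: pairwise_def disjnt_def)
  have \<P>_sub: "A \<subseteq> X" if "A \<in> \<P>" for A using that \<P>(2) measurable_subset by blast
  obtain N where N: "N \<subseteq> X" "\<And>x y. x \<in> N \<Longrightarrow> y \<in> N \<Longrightarrow> x \<noteq> y \<Longrightarrow> 2 < d x y"
    and near: "\<And>x. x \<in> X \<Longrightarrow> \<exists>n\<in>N. d x n \<le> 2"
    by (rule maximal_separated_set[of 2]) blast
  \<comment> \<open>One point of the piece is within 2 of some centre; the diameter bound adds
    \<open>r\<close> for the others, so the whole piece can be assigned to that centre.\<close>
  have "\<exists>n\<in>N. \<forall>a\<in>A. d a n \<le> r + 2" if A: "A \<in> \<P>" for A
  proof -
    have "A \<noteq> {}" using partition_onD3[OF \<P>(1)] A by auto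
    then obtain x where x: "x \<in> A" by blast
    then have "x \<in> X" using \<P>_sub[OF A] by blast
    then obtain n where n: "n \<in> N" "d x n \<le> 2" using near by blast
    have "d a n \<le> r + 2" if "a \<in> A" for a
    proof -
      have "d a n \<le> d a x + d x n"
        using that x n N(1) \<P>_sub[OF A] by (intro dist_triangle) auto
      also have "\<dots> \<le> r + 2"
        using dist_le_diam[OF that x] mesh[OF A] n(2) by (intro add_mono) auto
      finally show ?thesis .
    qed
    then show ?thesis using n(1) by blast
  qed
  then obtain c where c: "\<And>A. A \<in> \<P> \<Longrightarrow> c A \<in> N" "\<And>A a. A \<in> \<P> \<Longrightarrow> a \<in> A \<Longrightarrow> d a (c A) \<le> r + 2"
    by metis
  \<comment> \<open>Merging whole pieces keeps the result measurable: its trace on each old piece is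
    all or nothing.\<close>
  define B where "B n = \<Union>{A \<in> \<P>. c A = n}" for n
  \<comment> \<open>Only centres that are actually used, so that no merged piece is empty and
    \<open>B\<close> is injective on \<open>M\<close>.\<close>
  define M where "M = c ` \<P>"
  have MN: "M \<subseteq> N" "M \<subseteq> X" using c(1) N(1) by (auto simp: M_def)
  have B_sub: "B n \<subseteq> X" for n using \<P>_sub by (auto simp: B_def)
  have B_near: "d x n \<le> r + 2" if "x \<in> B n" for x n
    using that c(2) by (auto simp: B_def)
  have B_Int: "B n \<inter> A = (if c A = n then A else {})" if "A \<in> \<P>" for n A
    using that \<P>_eq by (auto simp: B_def)
  have B_meas: "B n \<in> \<AA>" for n
    by (rule meas[OF B_sub]) (use B_Int \<P>(2) measurable_empty in auto)
  have B_ne: "B n \<noteq> {}" if n: "n \<in> M" for n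
  proof -
    obtain A where A: "A \<in> \<P>" "c A = n" using n by (auto simp: M_def)
    then have "A \<noteq> {}" using partition_onD3[OF \<P>(1)] by auto
    then show ?thesis using A by (auto simp: B_def)
  qed
  have B_disj: "m = n" if "x \<in> B m" "x \<in> B n" for m n x
    using that \<P>_eq unfolding B_def by blast
  have r2: "r + 2 < \<infinity>" using r by (simp add: ennreal_add_less_top)
  have "locally_finite_module X d \<AA> P (B ` M) ((r + 2) + (r + 2))"
  proof
    show "partition_on X (B ` M)"
    proof (rule partition_onI)
      show "\<Union>(B ` M) = X"
      proof
        show "X \<subseteq> \<Union>(B ` M)"
          using partition_onD1[OF \<P>(1)] by (auto simp: B_def M_def)
      qed (use B_sub in blast)
      show "{} \<notin> B ` M" using B_ne by auto
      show "disjnt p q" if "p \<in> B ` M" "q \<in> B ` M" "p \<noteq> q" for p q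
        using that B_disj unfolding disjnt_def by blast
    qed
    show "B ` M \<subseteq> \<AA>" using B_meas by blast
    show "(r + 2) + (r + 2) < \<infinity>" using r2 by (simp add: ennreal_add_less_top)
    show "diam A \<le> (r + 2) + (r + 2)" if "A \<in> B ` M" for A
    proof (rule diam_le)
      fix x y assume xy: "x \<in> A" "y \<in> A"
      obtain n where n: "n \<in> M" "A = B n" using \<open>A \<in> B ` M\<close> by blast
      have X: "x \<in> X" "y \<in> X" "n \<in> X" using xy n B_sub MN by blast+
      have "d x y \<le> d x n + d n y" by (rule dist_triangle[OF X(1,3,2)])
      also have "\<dots> \<le> (r + 2) + (r + 2)"
        using B_near[of x n] B_near[of y n] xy n dist_commute[OF X(2,3)] by (intro add_mono) auto
      finally show "d x y \<le> (r + 2) + (r + 2)" .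
    qed
    show "((\<lambda>A. blinfun_apply (P A) x) has_sum x) (B ` M)" for x
    proof -
      have inj: "inj_on B M" using B_ne B_disj by (metis all_not_in_conv inj_onI)
      \<comment> \<open>The old sum is indexed by pairs of a centre and a piece assigned to it;
        summing the fibres first gives the sum over merged pieces.\<close>
      define I where "I n = {A \<in> \<P>. c A = n}" for n
      have image: "(\<lambda>A. (c A, A)) ` \<P> = Sigma M I"
      proof
        show "Sigma M I \<subseteq> (\<lambda>A. (c A, A)) ` \<P>"
        proof
          fix p assume "p \<in> Sigma M I"
          then have "p = (c (snd p), snd p)" "snd p \<in> \<P>" by (auto simp: I_def)
          then show "p \<in> (\<lambda>A. (c A, A)) ` \<P>" by (rule image_eqI)
        qed
      qed (auto simp: I_def M_def)
      have "((\<lambda>p. P (snd p) x) has_sum x) (Sigma M I)"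
        unfolding image[symmetric]
        by (subst has_sum_reindex) (use sum in \<open>auto simp: inj_on_def o_def\<close>)
      moreover have "((\<lambda>A. P (snd (n, A)) x) has_sum P (B n) x) (I n)" for n
      proof -
        have "((\<lambda>A. P (B n) (P A x)) has_sum P (B n) x) \<P>"
          by (rule has_sum_bounded_linear[OF blinfun.bounded_linear_right sum])
        moreover have "P (B n) (P A x) = (if c A = n then P A x else 0)" if A: "A \<in> \<P>" for A
        proof -
          have "P (B n) (P A x) = P (B n \<inter> A) x"
            using P_Int[OF B_meas, of A n] A \<P>(2) by auto
          then show ?thesis using B_Int[OF A] by (simp add: P_empty)
        qed
        ultimately show ?thesis
          by (subst (asm) has_sum_cong_neutral[where T = "I n" and g = "\<lambda>A. P A x"])
            (auto simp: I_def)
      qed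
      ultimately have "((\<lambda>n. P (B n) x) has_sum x) M" by (rule has_sum_SigmaD)
      then show ?thesis using has_sum_reindex[OF inj, of "\<lambda>A. blinfun_apply (P A) x"] by (simp add: o_def)
    qed
    show "C \<in> \<AA>" if C: "C \<subseteq> X" "\<And>A. A \<in> B ` M \<Longrightarrow> C \<inter> A \<in> \<AA>" for C
    proof (rule meas[OF C(1)])
      fix A assume A: "A \<in> \<P>"
      have "(C \<inter> B (c A)) \<inter> A \<in> \<AA>"
        using C(2)[of "B (c A)"] A \<P>(2) by (auto simp: M_def)
      then show "C \<inter> A \<in> \<AA>" using B_Int[OF A] by (simp add: Int_assoc)
    qed
    show "finite {A \<in> B ` M. A \<inter> C \<noteq> {}}" if C: "C \<subseteq> X" "diam C < \<infinity>" for C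
    proof (cases "C = {}")
      case False
      then obtain x where x: "x \<in> C" by blast
      \<comment> \<open>Bounds the distance from \<open>x\<close> to the centre of any merged piece
        meeting \<open>C\<close>, measured through a common point.\<close>
      let ?R = "diam C + (r + 2)"
      have "{A \<in> B ` M. A \<inter> C \<noteq> {}} \<subseteq> B ` (N \<inter> ecball x ?R)"
      proof clarsimp
        fix n assume n: "n \<in> M" "B n \<inter> C \<noteq> {}"
        then obtain y where y: "y \<in> B n" "y \<in> C" by blast
        have "d x n \<le> d x y + d y n" using x y n C MN by (intro dist_triangle) auto
        also have "\<dots> \<le> ?R"
          by (intro add_mono dist_le_diam x y B_near)
        finally have "n \<in> N \<inter> ecball x ?R" using n MN by (auto simp: ecball_def)
        then show "B n \<in> B ` (N \<inter> ecball x ?R)" by blast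
      qed
      moreover have "finite (N \<inter> ecball x ?R)"
        using x C r2 assms(1) N
        by (intro proper_separated_finite) (auto simp: ennreal_add_less_top)
      ultimately show ?thesis by (rule finite_subset[OF _ finite_imageI])
    qed simp
  qed
  then show thesis by (rule that)
qed

theorem corollaryI:
  fixes X :: "'x set" and d :: "'x \<Rightarrow> 'x \<Rightarrow> ennreal"
    and \<AA> :: "'x set set" and P :: "'x set \<Rightarrow> ('h::complex_hilbert_space \<Rightarrow>\<^sub>L 'h)"
  assumes "extended_metric_space X d" and "extended_metric_space.proper X d"
    and "X_module X d \<AA> P" and "X_module.ample X d \<AA> P" and "X_module.discrete X d \<AA> P"
  shows "multiplier_algebra (X_module.C_Roe d \<AA> P) = X_module.C_cp d \<AA> P"
proof -
  obtain \<Q> \<rho> where "locally_finite_module X d \<AA> P \<Q> \<rho>"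
    using X_module.locally_finite_coarsening[OF assms(3,2,5)] .
  then interpret locally_finite_module X d \<AA> P \<Q> \<rho> .
  show ?thesis
    using multiplier_subset_C_cp C_cp_subset_multiplier by (rule equalityI)
qed

end
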